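(* Let $\mathcal G$ be an ultragraph satisfying Condition (RFUM2) and let $K$ be a field. If the ultragraph Leavitt path algebra $L_K(\mathcal G)$ is residually finite-dimensional, then $\mathcal G$ satisfies the graph-theoretic RFD conditions (B1)--(B4).
   Context: Ultragraphs. An ultragraph is a quadruple $\mathcal G=(G^0,\mathcal G^1,r,s)$ with $G^0$ a set of vertices, $\mathcal G^1$ a set of edges, $s:\mathcal G^1\to G^0$ and $r:\mathcal G^1\to\mathcal P(G^0)\setminus\{\emptyset\}$. $\mathcal G^0$ is the smallest collection of subsets of $G^0$ containing all singletons $\{v\}$ and all ranges $r(e)$ and closed under finite unions and finite intersections (with $\emptyset\in\mathcal G^0$). A path of length $n\ge1$ is a word $\alpha=e_1\cdots e_n$ of edges with $s(e_{i+1})\in r(e_i)$ for $1\le i<n$; $s(\alpha)=s(e_1)$, $r(\alpha)=r(e_n)$. A vertex $v$ is a sink if $s^{-1}(v)=\emptyset$, and regular if $0<|s^{-1}(v)|<\infty$. For $A\in\mathcal G^0$ let $\varepsilon(A)=\{e\in\mathcal G^1:s(e)\in A\}$; $A$ is an infinite emitter if $|\varepsilon(A)|=\infty$. $A\in\mathcal G^0$ is a minimal infinite emitter if $|\varepsilon(A)|=\infty$ and no proper subset $B\subsetneq A$ with $B\in\mathcal G^0$ is either an infinite emitter or an infinite set with $|\varepsilon(B)|<\infty$. $A\in\mathcal G^0$ is a minimal sink if $|A|=\infty$, $|\varepsilon(A)|<\infty$ and no proper subset $B\subsetneq A$ with $B\in\mathcal G^0$ is infinite. Condition (RFUM2): every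 range $r(e)$, $e\in\mathcal G^1$, is a finite union of minimal infinite emitters, minimal sinks, and singletons $\{v\}$ with $v$ a sink or a regular vertex. Terminal boundary sets. $\mathcal A\subseteq\mathcal G^0$ is the collection of all minimal infinite emitters, all minimal sinks, and all $\{v\}$ with $v$ a sink; its elements are terminal boundary sets. Cycles. A cycle is a path $c=e_1\cdots e_n$, $n\ge1$, with $s(e_1)\in r(e_n)$ and $s(e_1),\dots,s(e_n)$ distinct; the vertices on $c$ are the $s(e_i)$. An exit for $c$ is either an edge $f$ with $s(f)\in r(e_i)$ and $f\ne e_{i+1}$ for some $i$ (indices cyclic), or a sink $w\in r(e_i)$ for some $i$. Graph-theoretic RFD conditions. (B1) No infinite receivers: for every $v\in G^0$ the set $\{e\in\mathcal G^1:v\in r(e)\}$ is finite. (B2) No cycle has an exit. (B3) No infinite backward chains: there is no infinite sequence of distinct edges $e_1,e_2,e_3,\dots$ with $s(e_i)\in r(e_{i+1})$ for all $i\ge1$. (B4) Every $v\in G^0$ reaches a terminal boundary set (i.e. $\{v\}\in\mathcal A$, or there are a path $\alpha$ with $|\alpha|\ge1$, $s(\alpha)=v$, and $A\in\mathcal A$ with $A\subseteq r(\alpha)$) or reaches a cycle (i.e. $v$ lies on a cycle, or there is a path $\alpha$ with $|\alpha|\ge1$, $s(\alpha)=v$, such that $r(\alpha)$ contains a vertex lying on a cycle). Algebra. $L_K(\mathcal G)$ is the universal $K$-algebra generated by $\{s_e,s_e^*:e\in\mathcal G^1\}\cup\{p_A:A\in\mathcal G^0\}$ subject to: $p_\emptyset=0$,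 $p_Ap_B=p_{A\cap B}$, $p_{A\cup B}=p_A+p_B-p_{A\cap B}$; $p_{s(e)}s_e=s_ep_{r(e)}=s_e$ and $p_{r(e)}s_e^*=s_e^*p_{s(e)}=s_e^*$; $s_e^*s_f=\delta_{e,f}p_{r(e)}$; $p_v=\sum_{s(e)=v}s_es_e^*$ for every regular vertex $v$ (where $p_v:=p_{\{v\}}$). RFD. A $K$-algebra $A$ is residually finite-dimensional (RFD) if for every $0\ne a\in A$ there are a finite-dimensional $K$-vector space $V$ and a $K$-algebra homomorphism $\pi:A\to\operatorname{End}_K(V)$ with $\pi(a)\ne0$. *)

theory Defs
  imports Complex_Main "HOL-Library.FuncSet" "HOL-Library.Poly_Mapping"
begin

section \<open>Ultragraphs\<close>

record ('v, 'e) ultragraph =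
  verts :: "'v set"
  edges :: "'e set"
  src :: "'e \<Rightarrow> 'v"
  rng :: "'e \<Rightarrow> 'v set"

locale ultragraph =
  fixes G :: "('v, 'e) ultragraph"
  assumes src_in: "e \<in> edges G \<Longrightarrow> src G e \<in> verts G"
    and rng_sub: "e \<in> edges G \<Longrightarrow> rng G e \<subseteq> verts G"
    and rng_nonempty: "e \<in> edges G \<Longrightarrow> rng G e \<noteq> {}"

inductive_set gen_verts :: "('v, 'e) ultragraph \<Rightarrow> 'v set set" for G where
  empty: "{} \<in> gen_verts G"
| singleton: "v \<in> verts G \<Longrightarrow> {v} \<in> gen_verts G"
| range: "e \<in> edges G \<Longrightarrow> rng G e \<in> gen_verts G"
| union: "A \<in> gen_verts G \<Longrightarrow> B \<in> gen_verts G \<Longrightarrow> A \<union> B \<in> gen_verts G"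
| inter: "A \<in> gen_verts G \<Longrightarrow> B \<in> gen_verts G \<Longrightarrow> A \<inter> B \<in> gen_verts G"

text \<open>Paths of length at least one; the source of a path \<open>\<alpha>\<close> is \<open>src G (hd \<alpha>)\<close> and
  its range is \<open>rng G (last \<alpha>)\<close>.\<close>

definition is_path :: "('v, 'e) ultragraph \<Rightarrow> 'e list \<Rightarrow> bool" where
  "is_path G \<alpha> \<longleftrightarrow> \<alpha> \<noteq> [] \<and> set \<alpha> \<subseteq> edges G \<and>
     (\<forall>i. Suc i < length \<alpha> \<longrightarrow> src G (\<alpha> ! Suc i) \<in> rng G (\<alpha> ! i))"

definition emitted :: "('v, 'e) ultragraph \<Rightarrow> 'v set \<Rightarrow> 'e set" where
  "emitted G A = {e \<in> edges G. src G e \<in> A}"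

definition is_sink :: "('v, 'e) ultragraph \<Rightarrow> 'v \<Rightarrow> bool" where
  "is_sink G v \<longleftrightarrow> v \<in> verts G \<and> {e \<in> edges G. src G e = v} = {}"

definition is_regular :: "('v, 'e) ultragraph \<Rightarrow> 'v \<Rightarrow> bool" where
  "is_regular G v \<longleftrightarrow> v \<in> verts G \<and> {e \<in> edges G. src G e = v} \<noteq> {} \<and>
     finite {e \<in> edges G. src G e = v}"

definition infinite_emitter :: "('v, 'e) ultragraph \<Rightarrow> 'v set \<Rightarrow> bool" where
  "infinite_emitter G A \<longleftrightarrow> A \<in> gen_verts G \<and> infinite (emitted G A)"

definition minimal_infinite_emitter :: "('v, 'e) ultragraph \<Rightarrow> 'v set \<Rightarrow> bool" where
  "minimal_infinite_emitter G A \<longleftrightarrow> infinite_emitter G A \<and>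
     \<not> (\<exists>B \<in> gen_verts G. B \<subset> A \<and>
          (infinite_emitter G B \<or> infinite B \<and> finite (emitted G B)))"

definition minimal_sink :: "('v, 'e) ultragraph \<Rightarrow> 'v set \<Rightarrow> bool" where
  "minimal_sink G A \<longleftrightarrow> A \<in> gen_verts G \<and> infinite A \<and> finite (emitted G A) \<and>
     \<not> (\<exists>B \<in> gen_verts G. B \<subset> A \<and> infinite B)"

definition RFUM2 :: "('v, 'e) ultragraph \<Rightarrow> bool" where
  "RFUM2 G \<longleftrightarrow> (\<forall>e \<in> edges G. \<exists>\<F>. finite \<F> \<and> rng G e = \<Union>\<F> \<and>
     (\<forall>A \<in> \<F>. minimal_infinite_emitter G A \<or> minimal_sink G A \<or>
        (\<exists>v. A = {v} \<and> (is_sink G v \<or> is_regular G v))))"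

definition terminal_boundary :: "('v, 'e) ultragraph \<Rightarrow> 'v set set" where
  "terminal_boundary G = {A. minimal_infinite_emitter G A \<or> minimal_sink G A \<or>
     (\<exists>v. A = {v} \<and> is_sink G v)}"


section \<open>Cycles and the graph-theoretic RFD conditions\<close>

definition is_cycle :: "('v, 'e) ultragraph \<Rightarrow> 'e list \<Rightarrow> bool" where
  "is_cycle G c \<longleftrightarrow> is_path G c \<and> src G (hd c) \<in> rng G (last c) \<and> distinct (map (src G) c)"

definition has_exit :: "('v, 'e) ultragraph \<Rightarrow> 'e list \<Rightarrow> bool" where
  "has_exit G c \<longleftrightarrow> (\<exists>i < length c.
     (\<exists>f \<in> edges G. src G f \<in> rng G (c ! i) \<and> f \<noteq> c ! (Suc i mod length c)) \<or>
     (\<exists>w \<in> rng G (c ! i). is_sink G w))"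

definition on_cycle :: "('v, 'e) ultragraph \<Rightarrow> 'v \<Rightarrow> bool" where
  "on_cycle G v \<longleftrightarrow> (\<exists>c. is_cycle G c \<and> v \<in> src G ` set c)"

definition reaches_terminal :: "('v, 'e) ultragraph \<Rightarrow> 'v \<Rightarrow> bool" where
  "reaches_terminal G v \<longleftrightarrow> {v} \<in> terminal_boundary G \<or>
     (\<exists>\<alpha>. is_path G \<alpha> \<and> src G (hd \<alpha>) = v \<and> (\<exists>A \<in> terminal_boundary G. A \<subseteq> rng G (last \<alpha>)))"

definition reaches_cycle :: "('v, 'e) ultragraph \<Rightarrow> 'v \<Rightarrow> bool" where
  "reaches_cycle G v \<longleftrightarrow> on_cycle G v \<or>
     (\<exists>\<alpha>. is_path G \<alpha> \<and> src G (hd \<alpha>) = v \<and> (\<exists>w \<in> rng G (last \<alpha>). on_cycle G w))"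

definition no_infinite_receivers :: "('v, 'e) ultragraph \<Rightarrow> bool" where
  "no_infinite_receivers G \<longleftrightarrow> (\<forall>v \<in> verts G. finite {e \<in> edges G. v \<in> rng G e})"

definition no_cycle_has_exit :: "('v, 'e) ultragraph \<Rightarrow> bool" where
  "no_cycle_has_exit G \<longleftrightarrow> (\<forall>c. is_cycle G c \<longrightarrow> \<not> has_exit G c)"

definition no_infinite_backward_chains :: "('v, 'e) ultragraph \<Rightarrow> bool" where
  "no_infinite_backward_chains G \<longleftrightarrow> \<not> (\<exists>e :: nat \<Rightarrow> 'e. inj e \<and> range e \<subseteq> edges G \<and>
     (\<forall>i. src G (e i) \<in> rng G (e (Suc i))))"

definition all_reach_terminal_or_cycle :: "('v, 'e) ultragraph \<Rightarrow> bool" where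
  "all_reach_terminal_or_cycle G \<longleftrightarrow> (\<forall>v \<in> verts G. reaches_terminal G v \<or> reaches_cycle G v)"

definition graph_RFD :: "('v, 'e) ultragraph \<Rightarrow> bool" where
  "graph_RFD G \<longleftrightarrow> no_infinite_receivers G \<and> no_cycle_has_exit G \<and>
     no_infinite_backward_chains G \<and> all_reach_terminal_or_cycle G"


section \<open>Algebras over a field\<close>

text \<open>Associative algebras that need not have a unit: the algebra of an ultragraph is unital
  only if the vertex set belongs to \<^term>\<open>gen_verts G\<close>. Homomorphisms are accordingly not
  required to preserve units.\<close>

record ('k, 'a) kalg =
  carr :: "'a set"
  zer :: 'a
  add :: "'a \<Rightarrow> 'a \<Rightarrow> 'a"
  mul :: "'a \<Rightarrow> 'a \<Rightarrow> 'a"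
  scl :: "'k \<Rightarrow> 'a \<Rightarrow> 'a"

locale k_algebra =
  fixes A :: "('k::field, 'a) kalg"
  assumes zer_closed: "zer A \<in> carr A"
    and add_closed: "x \<in> carr A \<Longrightarrow> y \<in> carr A \<Longrightarrow> add A x y \<in> carr A"
    and mul_closed: "x \<in> carr A \<Longrightarrow> y \<in> carr A \<Longrightarrow> mul A x y \<in> carr A"
    and scl_closed: "x \<in> carr A \<Longrightarrow> scl A c x \<in> carr A"
    and add_assoc: "x \<in> carr A \<Longrightarrow> y \<in> carr A \<Longrightarrow> z \<in> carr A \<Longrightarrow>
      add A (add A x y) z = add A x (add A y z)"
    and add_comm: "x \<in> carr A \<Longrightarrow> y \<in> carr A \<Longrightarrow> add A x y = add A y x"
    and add_zer: "x \<in> carr A \<Longrightarrow> add A x (zer A) = x"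
    and add_inv: "x \<in> carr A \<Longrightarrow> add A x (scl A (-1) x) = zer A"
    and mul_assoc: "x \<in> carr A \<Longrightarrow> y \<in> carr A \<Longrightarrow> z \<in> carr A \<Longrightarrow>
      mul A (mul A x y) z = mul A x (mul A y z)"
    and mul_add_left: "x \<in> carr A \<Longrightarrow> y \<in> carr A \<Longrightarrow> z \<in> carr A \<Longrightarrow>
      mul A (add A x y) z = add A (mul A x z) (mul A y z)"
    and mul_add_right: "x \<in> carr A \<Longrightarrow> y \<in> carr A \<Longrightarrow> z \<in> carr A \<Longrightarrow>
      mul A x (add A y z) = add A (mul A x y) (mul A x z)"
    and scl_add: "x \<in> carr A \<Longrightarrow> y \<in> carr A \<Longrightarrow>
      scl A c (add A x y) = add A (scl A c x) (scl A c y)"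
    and add_scl: "x \<in> carr A \<Longrightarrow> scl A (c + d) x = add A (scl A c x) (scl A d x)"
    and scl_scl: "x \<in> carr A \<Longrightarrow> scl A c (scl A d x) = scl A (c * d) x"
    and scl_one: "x \<in> carr A \<Longrightarrow> scl A 1 x = x"
    and mul_scl_left: "x \<in> carr A \<Longrightarrow> y \<in> carr A \<Longrightarrow>
      mul A (scl A c x) y = scl A c (mul A x y)"
    and mul_scl_right: "x \<in> carr A \<Longrightarrow> y \<in> carr A \<Longrightarrow>
      mul A x (scl A c y) = scl A c (mul A x y)"

definition kalg_hom :: "('k, 'a) kalg \<Rightarrow> ('k, 'b) kalg \<Rightarrow> ('a \<Rightarrow> 'b) set" where
  "kalg_hom A B = {\<phi> \<in> carr A \<rightarrow> carr B.
     (\<forall>x \<in> carr A. \<forall>y \<in> carr A. \<phi> (add A x y) = add B (\<phi> x) (\<phi> y)) \<and>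
     (\<forall>x \<in> carr A. \<forall>y \<in> carr A. \<phi> (mul A x y) = mul B (\<phi> x) (\<phi> y)) \<and>
     (\<forall>c. \<forall>x \<in> carr A. \<phi> (scl A c x) = scl B c (\<phi> x))}"


section \<open>Finite-dimensional vector spaces and their endomorphisms\<close>

definition pm_scale :: "'k::field \<Rightarrow> ('b \<Rightarrow>\<^sub>0 'k) \<Rightarrow> ('b \<Rightarrow>\<^sub>0 'k)" where
  "pm_scale c = Poly_Mapping.map ((*) c)"

lemma lookup_pm_scale [simp]: "Poly_Mapping.lookup (pm_scale c x) b = c * Poly_Mapping.lookup x b"
  by (simp add: pm_scale_def Poly_Mapping.map.rep_eq when_def)

global_interpretation pm: vector_space pm_scale
  by standard (auto intro!: poly_mapping_eqI simp: lookup_add algebra_simps)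

text \<open>HOL cannot quantify over all vector spaces inside a formula. Every finite-dimensional
  \<open>K\<close>-vector space is isomorphic to a subspace of the space of finitely supported sequences
  in \<open>K\<close>, so it suffices to let \<open>V\<close> range over these.\<close>

definition fin_dim_space :: "(nat \<Rightarrow>\<^sub>0 'k::field) set \<Rightarrow> bool" where
  "fin_dim_space V \<longleftrightarrow> (\<exists>B. finite B \<and> V = pm.span B)"

text \<open>An endomorphism of \<open>V\<close> is represented by its extensional restriction to \<open>V\<close>, so that
  two endomorphisms are equal iff they agree on \<open>V\<close>.\<close>

definition End :: "('b \<Rightarrow>\<^sub>0 'k::field) set \<Rightarrow> ('k, ('b \<Rightarrow>\<^sub>0 'k) \<Rightarrow> ('b \<Rightarrow>\<^sub>0 'k)) kalg" where
  "End V = \<lparr>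
     carr = {f \<in> V \<rightarrow>\<^sub>E V. (\<forall>x \<in> V. \<forall>y \<in> V. f (x + y) = f x + f y) \<and>
                        (\<forall>c. \<forall>x \<in> V. f (pm_scale c x) = pm_scale c (f x))},
     zer = (\<lambda>x \<in> V. 0),
     add = (\<lambda>f g. \<lambda>x \<in> V. f x + g x),
     mul = (\<lambda>f g. compose V f g),
     scl = (\<lambda>c f. \<lambda>x \<in> V. pm_scale c (f x))\<rparr>"

lemma k_algebra_End:
  assumes "pm.subspace V"
  shows "k_algebra (End V)"
proof -
  note sub = pm.subspace_0[OF assms] pm.subspace_add[OF assms] pm.subspace_scale[OF assms]
  have neg: "x + pm_scale (- 1) x = 0" for x :: "'b \<Rightarrow>\<^sub>0 'a"
    by (rule poly_mapping_eqI) (simp add: lookup_add)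
  have mem: "f x \<in> V" if "f \<in> carr (End V)" "x \<in> V" for f x
    using that by (auto simp: End_def)
  have ext: "f = g" if "f \<in> carr (End V)" "g \<in> carr (End V)" "\<And>x. x \<in> V \<Longrightarrow> f x = g x" for f g
    using that by (auto simp: End_def intro: PiE_ext)
  have lin_add: "f (x + y) = f x + f y" if "f \<in> carr (End V)" "x \<in> V" "y \<in> V" for f x y
    using that by (auto simp: End_def)
  have lin_scale: "f (pm_scale c x) = pm_scale c (f x)" if "f \<in> carr (End V)" "x \<in> V" for f x c
    using that by (auto simp: End_def)
  have ops: "zer (End V) x = 0" "add (End V) f g x = f x + g x" "mul (End V) f g x = f (g x)"
    "scl (End V) c f x = pm_scale c (f x)" if "x \<in> V" for f g c x
    using that by (auto simp: End_def compose_def)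
  have zero: "zer (End V) \<in> carr (End V)"
    by (auto simp: End_def sub)
  have plus: "add (End V) f g \<in> carr (End V)" if "f \<in> carr (End V)" "g \<in> carr (End V)" for f g
    using that by (auto simp: End_def sub pm.scale_right_distrib Pi_iff PiE_iff algebra_simps)
  have comp: "mul (End V) f g \<in> carr (End V)" if "f \<in> carr (End V)" "g \<in> carr (End V)" for f g
    using that by (auto simp: End_def sub compose_def Pi_iff PiE_iff)
  have scal: "scl (End V) c f \<in> carr (End V)" if "f \<in> carr (End V)" for f c
    using that by (auto simp: End_def sub pm.scale_right_distrib Pi_iff PiE_iff mult.commute)
  show ?thesis
  proof (unfold_locales, goal_cases)
    case 1 show ?case by (fact zero)
  next
    case 2 then show ?case by (rule plus)
  next
    case 3 then show ?case by (rule comp)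
  next
    case 4 then show ?case by (rule scal)
  next
    case 5 then show ?case by (intro ext plus) (simp_all add: ops add.assoc)
  next
    case 6 then show ?case by (intro ext plus) (simp_all add: ops add.commute)
  next
    case 7 then show ?case by (intro ext plus zero) (simp_all add: ops)
  next
    case 8 then show ?case by (intro ext plus scal zero) (simp_all add: ops neg)
  next
    case 9 then show ?case by (intro ext comp) (simp_all add: ops mem)
  next
    case 10 then show ?case by (intro ext comp plus) (simp_all add: ops mem)
  next
    case (11 f g h) then show ?case
      by (intro ext comp plus) (simp_all add: ops mem lin_add[of f])
  next
    case 12 then show ?case
      by (intro ext scal plus) (simp_all add: ops pm.scale_right_distrib)
  next
    case 13 then show ?case
      by (intro ext scal plus) (simp_all add: ops pm.scale_left_distrib)
  next
    case 14 then show ?case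
      by (intro ext scal) (simp_all add: ops)
  next
    case 15 then show ?case by (intro ext scal) (simp_all add: ops)
  next
    case 16 then show ?case by (intro ext scal comp) (simp_all add: ops mem)
  next
    case (17 f g) then show ?case
      by (intro ext scal comp) (simp_all add: ops mem lin_scale[of f])
  qed
qed

definition residually_finite_dimensional :: "('k::field, 'a) kalg \<Rightarrow> bool" where
  "residually_finite_dimensional A \<longleftrightarrow> (\<forall>a \<in> carr A. a \<noteq> zer A \<longrightarrow>
     (\<exists>V :: (nat \<Rightarrow>\<^sub>0 'k) set. fin_dim_space V \<and>
        (\<exists>\<pi> \<in> kalg_hom A (End V). \<pi> a \<noteq> zer (End V))))"


section \<open>The ultragraph Leavitt path algebra\<close>

text \<open>Words over an alphabet, as a monoid under concatenation. With this monoid as exponents,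
  the convolution ring \<open>'g word \<Rightarrow>\<^sub>0 'k\<close> is the free unital associative algebra over \<open>'g\<close>.\<close>

datatype 'g word = Word (letters: "'g list")

instantiation word :: (type) monoid_add
begin

definition zero_word :: "'a word" where
  "0 = Word []"

definition plus_word :: "'a word \<Rightarrow> 'a word \<Rightarrow> 'a word" where
  "u + w = Word (letters u @ letters w)"

instance
  by standard (auto simp: zero_word_def plus_word_def)

end

datatype ('v, 'e) gen = S 'e | Sstar 'e | P "'v set"

type_synonym ('v, 'e, 'k) free_alg = "('v, 'e) gen word \<Rightarrow>\<^sub>0 'k"

definition gens :: "('v, 'e) ultragraph \<Rightarrow> ('v, 'e) gen set" where
  "gens G = S ` edges G \<union> Sstar ` edges G \<union> P ` gen_verts G"

text \<open>The free algebra without unit: linear combinations of nonempty words in the generators.\<close>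

definition free_carrier :: "('v, 'e) ultragraph \<Rightarrow> ('v, 'e, 'k::field) free_alg set" where
  "free_carrier G = {x. \<forall>w \<in> Poly_Mapping.keys x. letters w \<noteq> [] \<and> set (letters w) \<subseteq> gens G}"

definition \<iota> :: "('v, 'e) gen \<Rightarrow> ('v, 'e, 'k::field) free_alg" where
  "\<iota> g = Poly_Mapping.single (Word [g]) 1"

inductive_set relators :: "('v, 'e) ultragraph \<Rightarrow> ('v, 'e, 'k::field) free_alg set" for G where
  p_empty: "\<iota> (P {}) \<in> relators G"
| p_inter: "A \<in> gen_verts G \<Longrightarrow> B \<in> gen_verts G \<Longrightarrow>
    \<iota> (P A) * \<iota> (P B) - \<iota> (P (A \<inter> B)) \<in> relators G"
| p_union: "A \<in> gen_verts G \<Longrightarrow> B \<in> gen_verts G \<Longrightarrow>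
    \<iota> (P (A \<union> B)) - (\<iota> (P A) + \<iota> (P B) - \<iota> (P (A \<inter> B))) \<in> relators G"
| src_s: "e \<in> edges G \<Longrightarrow> \<iota> (P {src G e}) * \<iota> (S e) - \<iota> (S e) \<in> relators G"
| s_rng: "e \<in> edges G \<Longrightarrow> \<iota> (S e) * \<iota> (P (rng G e)) - \<iota> (S e) \<in> relators G"
| rng_sstar: "e \<in> edges G \<Longrightarrow> \<iota> (P (rng G e)) * \<iota> (Sstar e) - \<iota> (Sstar e) \<in> relators G"
| sstar_src: "e \<in> edges G \<Longrightarrow> \<iota> (Sstar e) * \<iota> (P {src G e}) - \<iota> (Sstar e) \<in> relators G"
| sstar_s: "e \<in> edges G \<Longrightarrow> f \<in> edges G \<Longrightarrow>
    \<iota> (Sstar e) * \<iota> (S f) - (if e = f then \<iota> (P (rng G e)) else 0) \<in> relators G"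
| regular: "is_regular G v \<Longrightarrow>
    \<iota> (P {v}) - (\<Sum>e \<in> {e \<in> edges G. src G e = v}. \<iota> (S e) * \<iota> (Sstar e)) \<in> relators G"

inductive_set relator_ideal :: "('v, 'e) ultragraph \<Rightarrow> ('v, 'e, 'k::field) free_alg set" for G where
  zero: "0 \<in> relator_ideal G"
| relator: "x \<in> relators G \<Longrightarrow> x \<in> relator_ideal G"
| add: "x \<in> relator_ideal G \<Longrightarrow> y \<in> relator_ideal G \<Longrightarrow> x + y \<in> relator_ideal G"
| scale: "x \<in> relator_ideal G \<Longrightarrow> pm_scale c x \<in> relator_ideal G"
| left: "a \<in> free_carrier G \<Longrightarrow> x \<in> relator_ideal G \<Longrightarrow> a * x \<in> relator_ideal G"
| right: "x \<in> relator_ideal G \<Longrightarrow> a \<in> free_carrier G \<Longrightarrow> x * a \<in> relator_ideal G"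

definition lpa_class ::
    "('v, 'e) ultragraph \<Rightarrow> ('v, 'e, 'k::field) free_alg \<Rightarrow> ('v, 'e, 'k) free_alg set" where
  "lpa_class G x = {y \<in> free_carrier G. y - x \<in> relator_ideal G}"

definition leavitt_path_algebra ::
    "('v, 'e) ultragraph \<Rightarrow> ('k::field, ('v, 'e, 'k) free_alg set) kalg" where
  "leavitt_path_algebra G = \<lparr>
     carr = lpa_class G ` free_carrier G,
     zer = lpa_class G 0,
     add = (\<lambda>X Y. \<Union>x \<in> X. \<Union>y \<in> Y. lpa_class G (x + y)),
     mul = (\<lambda>X Y. \<Union>x \<in> X. \<Union>y \<in> Y. lpa_class G (x * y)),
     scl = (\<lambda>c X. \<Union>x \<in> X. lpa_class G (pm_scale c x))\<rparr>"

lemma pm_scale_mult: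
  fixes x y :: "'g::monoid_add \<Rightarrow>\<^sub>0 'k::field"
  shows "pm_scale c x * y = pm_scale c (x * y)" and "x * pm_scale c y = pm_scale c (x * y)"
proof -
  have central: "x * Poly_Mapping.single 0 c = Poly_Mapping.single 0 c * x"
    for x :: "'g \<Rightarrow>\<^sub>0 'k"
  proof (induction x rule: update_induct)
    case const
    show ?case by simp
  next
    case (update f a b)
    have "Poly_Mapping.update a b f = Poly_Mapping.single a b + f"
      using update.hyps
      by (intro poly_mapping_eqI)
        (auto simp: lookup_update lookup_add lookup_single in_keys_iff when_def)
    then show ?case
      using update.IH by (simp add: distrib_left distrib_right mult_single mult.commute)
  qed
  show "pm_scale c x * y = pm_scale c (x * y)"
    by (simp add: pm_scale_def mult_map_scale_conv_mult mult.assoc)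
  show "x * pm_scale c y = pm_scale c (x * y)"
    by (simp add: pm_scale_def mult_map_scale_conv_mult central flip: mult.assoc)
qed

lemma free_carrier_0: "0 \<in> free_carrier G"
  by (simp add: free_carrier_def)

lemma free_carrier_add:
  "x \<in> free_carrier G \<Longrightarrow> y \<in> free_carrier G \<Longrightarrow> x + y \<in> free_carrier G"
  using Poly_Mapping.keys_add[of x y] by (auto simp: free_carrier_def)

lemma free_carrier_scale:
  "x \<in> free_carrier G \<Longrightarrow> pm_scale c x \<in> free_carrier G"
  by (auto simp: free_carrier_def in_keys_iff)

lemma free_carrier_mult:
  assumes "x \<in> free_carrier G" "y \<in> free_carrier G"
  shows "x * y \<in> free_carrier G"
  unfolding free_carrier_def
proof (intro CollectI ballI)
  fix w assume "w \<in> Poly_Mapping.keys (x * y)"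
  then obtain a b where "w = a + b" "a \<in> Poly_Mapping.keys x" "b \<in> Poly_Mapping.keys y"
    using keys_mult[of x y] by blast
  with assms show "letters w \<noteq> [] \<and> set (letters w) \<subseteq> gens G"
    by (auto simp: free_carrier_def plus_word_def)
qed

lemma relator_ideal_uminus: "x \<in> relator_ideal G \<Longrightarrow> - x \<in> relator_ideal G"
  using relator_ideal.scale[of x G "-1"] by (simp add: pm.scale_minus_left)

lemma relator_ideal_diff:
  "x \<in> relator_ideal G \<Longrightarrow> y \<in> relator_ideal G \<Longrightarrow> x - y \<in> relator_ideal G"
  using relator_ideal.add[of x G "- y"] relator_ideal_uminus[of y G] by simp

lemma lpa_class_cong:
  assumes "x - y \<in> relator_ideal G"
  shows "lpa_class G x = lpa_class G y"
proof -
  have "z - x \<in> relator_ideal G \<longleftrightarrow> z - y \<in> relator_ideal G" for z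
    using relator_ideal.add[OF _ assms, of "z - x"] relator_ideal_diff[OF _ assms, of "z - y"] by auto
  then show ?thesis
    by (simp add: lpa_class_def)
qed

lemma lpa_class_self: "x \<in> free_carrier G \<Longrightarrow> x \<in> lpa_class G x"
  by (simp add: lpa_class_def relator_ideal.zero)

lemma lpa_class_eq_iff:
  assumes "x \<in> free_carrier G"
  shows "lpa_class G x = lpa_class G y \<longleftrightarrow> x - y \<in> relator_ideal G"
proof
  assume "lpa_class G x = lpa_class G y"
  then show "x - y \<in> relator_ideal G"
    using lpa_class_self[OF assms] by (auto simp: lpa_class_def)
qed (rule lpa_class_cong)

lemma lpa_add:
  assumes "x \<in> free_carrier G" "y \<in> free_carrier G"
  shows "add (leavitt_path_algebra G) (lpa_class G x) (lpa_class G y) = lpa_class G (x + y)"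
proof -
  have "lpa_class G (x' + y') = lpa_class G (x + y)"
    if "x' \<in> lpa_class G x" "y' \<in> lpa_class G y" for x' y'
  proof (rule lpa_class_cong)
    have "(x' - x) + (y' - y) \<in> relator_ideal G"
      using that by (auto simp: lpa_class_def intro: relator_ideal.add)
    then show "x' + y' - (x + y) \<in> relator_ideal G"
      by (simp add: algebra_simps)
  qed
  then have "(\<Union>x' \<in> lpa_class G x. \<Union>y' \<in> lpa_class G y. lpa_class G (x' + y')) = lpa_class G (x + y)"
    using assms[THEN lpa_class_self] by blast
  then show ?thesis
    by (simp add: leavitt_path_algebra_def)
qed

lemma lpa_mul:
  assumes "x \<in> free_carrier G" "y \<in> free_carrier G"
  shows "mul (leavitt_path_algebra G) (lpa_class G x) (lpa_class G y) = lpa_class G (x * y)"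
proof -
  have "lpa_class G (x' * y') = lpa_class G (x * y)"
    if "x' \<in> lpa_class G x" "y' \<in> lpa_class G y" for x' y'
  proof (rule lpa_class_cong)
    have "x' - x \<in> relator_ideal G" "y' - y \<in> relator_ideal G" "y' \<in> free_carrier G"
      using that by (auto simp: lpa_class_def)
    then have "(x' - x) * y' + x * (y' - y) \<in> relator_ideal G"
      using assms(1) by (blast intro: relator_ideal.add relator_ideal.left relator_ideal.right)
    then show "x' * y' - x * y \<in> relator_ideal G"
      by (simp add: algebra_simps)
  qed
  then have "(\<Union>x' \<in> lpa_class G x. \<Union>y' \<in> lpa_class G y. lpa_class G (x' * y')) = lpa_class G (x * y)"
    using assms[THEN lpa_class_self] by blast
  then show ?thesis
    by (simp add: leavitt_path_algebra_def)
qed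

lemma lpa_scl:
  assumes "x \<in> free_carrier G"
  shows "scl (leavitt_path_algebra G) c (lpa_class G x) = lpa_class G (pm_scale c x)"
proof -
  have "lpa_class G (pm_scale c x') = lpa_class G (pm_scale c x)" if "x' \<in> lpa_class G x" for x'
  proof (rule lpa_class_cong)
    have "pm_scale c (x' - x) \<in> relator_ideal G"
      using that by (auto simp: lpa_class_def intro: relator_ideal.scale)
    then show "pm_scale c x' - pm_scale c x \<in> relator_ideal G"
      by (simp add: pm.scale_right_diff_distrib)
  qed
  then have "(\<Union>x' \<in> lpa_class G x. lpa_class G (pm_scale c x')) = lpa_class G (pm_scale c x)"
    using assms[THEN lpa_class_self] by blast
  then show ?thesis
    by (simp add: leavitt_path_algebra_def)
qed

lemma k_algebra_leavitt_path_algebra: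
  "k_algebra (leavitt_path_algebra G :: ('k::field, ('v, 'e, 'k) free_alg set) kalg)"
proof -
  let ?L = "leavitt_path_algebra G :: ('k, ('v, 'e, 'k) free_alg set) kalg"
  have carr: "carr ?L = lpa_class G ` free_carrier G" and zer: "zer ?L = lpa_class G 0"
    by (simp_all add: leavitt_path_algebra_def)
  have neg: "x + pm_scale (- 1) x = 0" for x :: "('v, 'e, 'k) free_alg"
    by (rule poly_mapping_eqI) (simp add: lookup_add)
  have rep: P if "X \<in> carr ?L" "\<And>x. x \<in> free_carrier G \<Longrightarrow> X = lpa_class G x \<Longrightarrow> P" for X P
    using that by (auto simp: carr)
  have closed: "lpa_class G x \<in> carr ?L" if "x \<in> free_carrier G" for x
    using that by (simp add: carr)
  note rules = zer closed lpa_add lpa_mul lpa_scl free_carrier_0 free_carrier_add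
    free_carrier_mult free_carrier_scale
  show ?thesis
  proof (unfold_locales, goal_cases)
    case 1 show ?case by (simp add: carr zer free_carrier_0)
  next
    case 2 then show ?case by (elim rep) (simp add: rules)
  next
    case 3 then show ?case by (elim rep) (simp add: rules)
  next
    case 4 then show ?case by (elim rep) (simp add: rules)
  next
    case 5 then show ?case by (elim rep) (simp add: rules add.assoc)
  next
    case 6 then show ?case by (elim rep) (simp add: rules add.commute)
  next
    case 7 then show ?case by (elim rep) (simp add: rules)
  next
    case 8 then show ?case by (elim rep) (simp only: rules neg)
  next
    case 9 then show ?case by (elim rep) (simp add: rules mult.assoc)
  next
    case 10 then show ?case by (elim rep) (simp add: rules distrib_right)
  next
    case 11 then show ?case by (elim rep) (simp add: rules distrib_left)
  next
    case 12 then show ?case by (elim rep) (simp add: rules pm.scale_right_distrib)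
  next
    case 13 then show ?case by (elim rep) (simp add: rules pm.scale_left_distrib)
  next
    case 14 then show ?case by (elim rep) (simp add: rules)
  next
    case 15 then show ?case by (elim rep) (simp add: rules)
  next
    case 16 then show ?case by (elim rep) (simp add: rules pm_scale_mult)
  next
    case 17 then show ?case by (elim rep) (simp add: rules pm_scale_mult)
  qed
qed

end

theory Submission
  imports Defs
begin

text \<open>Every $p_v$ is nonzero, since the algebra acts faithfully enough on functions on a branching
  system; so residual finite-dimensionality gives for each \<open>v\<close> a finite-dimensional representation
  with $p_v \neq 0$. In such a representation only finitely many $s_e$ are nonzero, because the
  idempotents $s_e s_e^*$ are orthogonal. On the other hand $s_e \neq 0$ whenever $p_w \neq 0$ for
  some $w \in r(e)$, so infinite receivers and infinite backward chains are impossible. A vertex reaching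
  neither a terminal boundary set nor a cycle is regular, as is every vertex reachable from it, and
  $p_v = \sum s_e s_e^*$ lets one walk forward forever along edges with $s_e \neq 0$; some edge
  repeats and closes a cycle. Finally the rank of $p_{s(e)}$ is at least that of $p_{r(e)}$; around
  a cycle all these ranks agree, so every exit acts as zero in every finite-dimensional
  representation.\<close>

section \<open>Dimension in a finitely spanned subspace\<close>

text \<open>A basis of \<open>W\<close> is finite, being independent inside \<open>span F\<close>;
  since it spans \<open>C\<close>, the exchange bound applies to it.\<close>

lemma (in vector_space) independent_card_le_dim_of_finite_span:
  assumes "independent C" "C \<subseteq> W" "W \<subseteq> span F" "finite F"
  shows "finite C \<and> card C \<le> dim W"
proof -
  obtain B where B: "B \<subseteq> W" "independent B" "W \<subseteq> span B" "card B = dim W"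
    using basis_exists by blast
  have "finite B"
    using independent_span_bound[OF assms(4) B(2)] B(1) assms(3) by blast
  then show ?thesis
    using independent_span_bound[of B C] assms(1,2) B by auto
qed

text \<open>A vector of \<open>W\<close> outside \<open>U\<close> would extend a basis of
  \<open>U\<close> to an independent subset of \<open>W\<close> with more than \<open>dim W\<close>
  elements.\<close>

lemma (in vector_space) subspace_eq_if_dim_le:
  assumes "subspace U" "U \<subseteq> W" "W \<subseteq> span F" "finite F" "dim W \<le> dim U"
  shows "U = W"
proof (rule ccontr)
  assume "U \<noteq> W"
  then obtain x where x: "x \<in> W" "x \<notin> U"
    using assms(2) by blast
  obtain B where B: "B \<subseteq> U" "independent B" "U \<subseteq> span B" "card B = dim U"
    using basis_exists by blast
  have "x \<notin> span B"
    using x(2) span_minimal[OF B(1) assms(1)] by blast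
  then have indep: "independent (insert x B)"
    using B(2) by (simp add: independent_insert)
  have "finite (insert x B) \<and> card (insert x B) \<le> dim W"
    by (rule independent_card_le_dim_of_finite_span[OF indep _ assms(3,4)])
      (use x(1) B(1) assms(2) in auto)
  moreover have "x \<notin> B"
    using x(2) B(1) by blast
  ultimately have "Suc (card B) \<le> dim W"
    by (metis card_insert_disjoint finite_insert)
  then show False
    using B(4) assms(5) by simp
qed

section \<open>Finite-dimensional representations\<close>

text \<open>The operators \<open>p A\<close>, \<open>s e\<close>, \<open>t e\<close> are the images of the generators $p_A$, $s_e$, $s_e^*$
  under a homomorphism into the endomorphisms of \<open>V\<close>.\<close>

locale fin_dim_rep = ultragraph G
  for G :: "('v, 'e) ultragraph" +
  fixes V :: "('b \<Rightarrow>\<^sub>0 'k::field) set"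
    and F :: "('b \<Rightarrow>\<^sub>0 'k) set"
    and p :: "'v set \<Rightarrow> ('b \<Rightarrow>\<^sub>0 'k) \<Rightarrow> ('b \<Rightarrow>\<^sub>0 'k)"
    and s t :: "'e \<Rightarrow> ('b \<Rightarrow>\<^sub>0 'k) \<Rightarrow> ('b \<Rightarrow>\<^sub>0 'k)"
  assumes finite_F: "finite F" and V_eq: "V = pm.span F"
    and p_closed: "A \<in> gen_verts G \<Longrightarrow> x \<in> V \<Longrightarrow> p A x \<in> V"
    and s_closed: "e \<in> edges G \<Longrightarrow> x \<in> V \<Longrightarrow> s e x \<in> V"
    and t_closed: "e \<in> edges G \<Longrightarrow> x \<in> V \<Longrightarrow> t e x \<in> V"
    and p_add: "A \<in> gen_verts G \<Longrightarrow> x \<in> V \<Longrightarrow> y \<in> V \<Longrightarrow> p A (x + y) = p A x + p A y"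
    and s_add: "e \<in> edges G \<Longrightarrow> x \<in> V \<Longrightarrow> y \<in> V \<Longrightarrow> s e (x + y) = s e x + s e y"
    and t_add: "e \<in> edges G \<Longrightarrow> x \<in> V \<Longrightarrow> y \<in> V \<Longrightarrow> t e (x + y) = t e x + t e y"
    and p_scale: "A \<in> gen_verts G \<Longrightarrow> x \<in> V \<Longrightarrow> p A (pm_scale c x) = pm_scale c (p A x)"
    and s_scale: "e \<in> edges G \<Longrightarrow> x \<in> V \<Longrightarrow> s e (pm_scale c x) = pm_scale c (s e x)"
    and t_scale: "e \<in> edges G \<Longrightarrow> x \<in> V \<Longrightarrow> t e (pm_scale c x) = pm_scale c (t e x)"
    and p_empty: "x \<in> V \<Longrightarrow> p {} x = 0"
    and p_inter: "A \<in> gen_verts G \<Longrightarrow> B \<in> gen_verts G \<Longrightarrow> x \<in> V \<Longrightarrow> p A (p B x) = p (A \<inter> B) x"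
    and p_union: "A \<in> gen_verts G \<Longrightarrow> B \<in> gen_verts G \<Longrightarrow> x \<in> V \<Longrightarrow>
      p (A \<union> B) x = p A x + p B x - p (A \<inter> B) x"
    and p_s: "e \<in> edges G \<Longrightarrow> x \<in> V \<Longrightarrow> p {src G e} (s e x) = s e x"
    and s_p: "e \<in> edges G \<Longrightarrow> x \<in> V \<Longrightarrow> s e (p (rng G e) x) = s e x"
    and p_t: "e \<in> edges G \<Longrightarrow> x \<in> V \<Longrightarrow> p (rng G e) (t e x) = t e x"
    and t_s: "e \<in> edges G \<Longrightarrow> f \<in> edges G \<Longrightarrow> x \<in> V \<Longrightarrow>
      t e (s f x) = (if e = f then p (rng G e) x else 0)"
    and p_regular: "is_regular G v \<Longrightarrow> x \<in> V \<Longrightarrow>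
      p {v} x = (\<Sum>e \<in> {e \<in> edges G. src G e = v}. s e (t e x))"
begin

lemma subspace_V: "pm.subspace V"
  by (simp add: V_eq)

lemma zero_V: "0 \<in> V"
  using subspace_V by (rule pm.subspace_0)

lemma src_gen: "e \<in> edges G \<Longrightarrow> {src G e} \<in> gen_verts G"
  by (simp add: gen_verts.singleton src_in)

lemma in_rng_gen: "e \<in> edges G \<Longrightarrow> w \<in> rng G e \<Longrightarrow> {w} \<in> gen_verts G"
  using rng_sub by (blast intro: gen_verts.singleton)

lemma s_zero: "e \<in> edges G \<Longrightarrow> s e 0 = 0"
  using s_add[of e 0 0] zero_V by simp

lemma t_zero: "e \<in> edges G \<Longrightarrow> t e 0 = 0"
  using t_add[of e 0 0] zero_V by simp

lemma p_zero: "A \<in> gen_verts G \<Longrightarrow> p A 0 = 0"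
  using p_add[of A 0 0] zero_V by simp

text \<open>If \<open>s e\<close> is nonzero then so is the idempotent \<open>s e \<circ> t e\<close>; for different edges these
  idempotents are orthogonal.\<close>

lemma finite_nonzero_edges: "finite {e \<in> edges G. \<exists>x \<in> V. s e x \<noteq> 0}" (is "finite ?E")
proof -
  obtain u where u: "\<And>e. e \<in> ?E \<Longrightarrow> u e \<in> V \<and> s e (u e) \<noteq> 0"
    by (rule that[of "\<lambda>e. SOME x. x \<in> V \<and> s e x \<noteq> 0"], rule someI_ex) blast
  \<comment> \<open>One nonzero vector from the image of each such \<open>s e\<close>; these are
    shown to be independent.\<close>
  define y where "y e = s e (u e)" for e
  have yV: "y e \<in> V" if "e \<in> ?E" for e
    using that u[OF that] s_closed by (auto simp: y_def)
  have ty: "t f (y e) = (if f = e then p (rng G e) (u e) else 0)" if "e \<in> ?E" "f \<in> edges G" for e f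
    using that u[OF that(1)] t_s[of f e "u e"] by (auto simp: y_def)
  have ty_nz: "t e (y e) \<noteq> 0" if e: "e \<in> ?E" for e
  proof
    assume "t e (y e) = 0"
    with e have "p (rng G e) (u e) = 0" using ty[OF e] by simp
    then have "s e (u e) = 0"
      using s_p[of e "u e"] s_zero[of e] e u[OF e] by auto
    then show False using u[OF e] by simp
  qed
  have inj: "inj_on y ?E"
  proof (rule inj_onI, rule ccontr)
    fix e f assume "e \<in> ?E" "f \<in> ?E" "y e = y f" "e \<noteq> f"
    then show False using ty_nz[of e] ty[of f e] by auto
  qed
  have "pm.independent (y ` ?E)"
    unfolding pm.dependent_def
  proof
    assume "\<exists>a \<in> y ` ?E. a \<in> pm.span (y ` ?E - {a})"
    then obtain e where e: "e \<in> ?E" and sp: "y e \<in> pm.span (y ` ?E - {y e})" by blast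
    have ee: "e \<in> edges G" using e by simp
    \<comment> \<open>The kernel of \<open>t e\<close> contains every \<open>y f\<close> with
      \<open>f\<close> different from \<open>e\<close>, but not \<open>y e\<close>.\<close>
    have "pm.subspace {z \<in> V. t e z = 0}"
      using subspace_V ee
      by (auto simp: pm.subspace_def t_zero t_add t_scale)
    moreover have "y ` ?E - {y e} \<subseteq> {z \<in> V. t e z = 0}"
    proof
      fix z assume "z \<in> y ` ?E - {y e}"
      then obtain f where f: "f \<in> ?E" "z = y f" "f \<noteq> e" by blast
      then show "z \<in> {z \<in> V. t e z = 0}" using yV[of f] ty[OF f(1) ee] by simp
    qed
    ultimately have "y e \<in> {z \<in> V. t e z = 0}"
      using sp pm.span_minimal by blast
    then show False using ty_nz[OF e] by simp
  qed
  moreover have "y ` ?E \<subseteq> pm.span F"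
    using yV by (auto simp: V_eq)
  ultimately have "finite (y ` ?E)"
    using pm.independent_span_bound[OF finite_F] by blast
  then show ?thesis
    using inj by (rule finite_imageD)
qed

text \<open>On the image of \<open>p {w}\<close> the operator \<open>s e\<close> has the left
  inverse \<open>t e\<close>, because \<open>p (rng G e)\<close> fixes that image. So
  \<open>s e\<close> does not vanish there, and its values are fixed by
  \<open>p {src G e}\<close>.\<close>

lemma nonzero_backward:
  assumes "e \<in> edges G" "w \<in> rng G e" "\<exists>x \<in> V. p {w} x \<noteq> 0"
  shows "\<exists>x \<in> V. s e x \<noteq> 0" and "\<exists>x \<in> V. p {src G e} x \<noteq> 0"
proof -
  obtain x where x: "x \<in> V" "p {w} x \<noteq> 0" using assms(3) by blast
  have pV: "p {w} x \<in> V" using p_closed in_rng_gen[OF assms(1,2)] x(1) by blast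
  have "t e (s e (p {w} x)) = p (rng G e \<inter> {w}) x"
    using t_s[OF assms(1,1) pV] p_inter[OF gen_verts.range[OF assms(1)] in_rng_gen[OF assms(1,2)] x(1)]
    by simp
  moreover have "rng G e \<inter> {w} = {w}" using assms(2) by blast
  ultimately have nz: "s e (p {w} x) \<noteq> 0"
    using x(2) t_zero[OF assms(1)] by auto
  show "\<exists>x \<in> V. s e x \<noteq> 0" using nz pV by blast
  have "p {src G e} (s e (p {w} x)) \<noteq> 0"
    using nz p_s[OF assms(1) pV] by simp
  then show "\<exists>x \<in> V. p {src G e} x \<noteq> 0"
    using s_closed[OF assms(1) pV] by blast
qed

text \<open>On a finite set the projection is the sum of the projections of its points, by
  \<open>p_union\<close> for disjoint sets. The induction carries membership in
  \<open>gen_verts G\<close>, which \<open>p_union\<close> demands.\<close>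

lemma nonzero_vertex_of_finite_set:
  assumes "finite A" "A \<subseteq> verts G" "x \<in> V" "p A x \<noteq> 0"
  shows "\<exists>w \<in> A. p {w} x \<noteq> 0"
proof (rule ccontr)
  assume none: "\<not> (\<exists>w \<in> A. p {w} x \<noteq> 0)"
  have "B \<in> gen_verts G \<and> p B x = 0" if "finite B" "B \<subseteq> A" for B
    using that
  proof (induction B rule: finite_induct)
    case empty
    show ?case by (simp add: gen_verts.empty p_empty assms(3))
  next
    case (insert w B)
    then have B: "B \<in> gen_verts G" "p B x = 0" and w: "{w} \<in> gen_verts G" "p {w} x = 0"
      using none assms(2) by (auto intro: gen_verts.singleton)
    have "{w} \<inter> B = {}" using insert.hyps by blast
    then have "p (insert w B) x = 0"
      using p_union[OF w(1) B(1) assms(3)] B w p_empty[OF assms(3)] by simp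
    moreover have "insert w B \<in> gen_verts G"
      using gen_verts.union[OF w(1) B(1)] by simp
    ultimately show ?case by blast
  qed
  then show False using assms(1,4) by blast
qed

section \<open>Images of the projections and their dimensions\<close>

lemma subspace_p: "A \<in> gen_verts G \<Longrightarrow> pm.subspace (p A ` V)"
proof (unfold pm.subspace_def, intro conjI ballI allI)
  assume A: "A \<in> gen_verts G"
  show "0 \<in> p A ` V" using p_zero[OF A] zero_V by force
  show "x + y \<in> p A ` V" if xy: "x \<in> p A ` V" "y \<in> p A ` V" for x y
  proof -
    from xy obtain a b where ab: "x = p A a" "y = p A b" "a \<in> V" "b \<in> V" by auto
    then have "x + y = p A (a + b)" using A p_add by simp
    then show ?thesis using ab pm.subspace_add[OF subspace_V] by blast
  qed
  show "pm_scale c x \<in> p A ` V" if x: "x \<in> p A ` V" for c x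
  proof -
    from x obtain a where a: "x = p A a" "a \<in> V" by auto
    then have "pm_scale c x = p A (pm_scale c a)" using A p_scale by simp
    then show ?thesis using a pm.subspace_scale[OF subspace_V] by blast
  qed
qed

lemma p_image_fixed:
  "A \<in> gen_verts G \<Longrightarrow> z \<in> p A ` V \<Longrightarrow> z \<in> V \<and> p A z = z"
  using p_closed p_inter[of A A] by auto

lemma p_image_mono:
  assumes "A \<in> gen_verts G" "B \<in> gen_verts G" "A \<subseteq> B"
  shows "p A ` V \<subseteq> p B ` V"
proof
  fix z assume "z \<in> p A ` V"
  then obtain x where x: "x \<in> V" "z = p A x" by blast
  have "B \<inter> A = A" using assms(3) by blast
  then have "z = p B z" "z \<in> V"
    using p_inter[OF assms(2,1) x(1)] x p_closed[OF assms(1)] by auto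
  then show "z \<in> p B ` V" by blast
qed

lemma dim_p_mono:
  assumes "A \<in> gen_verts G" "B \<in> gen_verts G" "A \<subseteq> B"
  shows "pm.dim (p A ` V) \<le> pm.dim (p B ` V)"
proof -
  obtain C where C: "C \<subseteq> p A ` V" "pm.independent C" "card C = pm.dim (p A ` V)"
    using pm.basis_exists by blast
  have "p B ` V \<subseteq> pm.span F" using p_closed[OF assms(2)] V_eq by auto
  then show ?thesis
    using pm.independent_card_le_dim_of_finite_span[OF C(2) _ _ finite_F, of "p B ` V"]
      p_image_mono[OF assms] C by auto
qed

lemma s_image:
  assumes "e \<in> edges G"
  shows "s e ` (p (rng G e) ` V) \<subseteq> p {src G e} ` V"
proof
  fix z assume "z \<in> s e ` (p (rng G e) ` V)"
  then obtain y where y: "y \<in> V" "z = s e y"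
    using p_closed[OF gen_verts.range[OF assms]] by auto
  then have "z = p {src G e} z" "z \<in> V"
    using p_s[OF assms y(1)] s_closed[OF assms] by auto
  then show "z \<in> p {src G e} ` V" by blast
qed

lemma subspace_s_image:
  assumes "e \<in> edges G"
  shows "pm.subspace (s e ` (p (rng G e) ` V))"
proof -
  have sub: "pm.subspace (p (rng G e) ` V)" (is "pm.subspace ?U")
    by (rule subspace_p[OF gen_verts.range[OF assms]])
  have UV: "?U \<subseteq> V" using p_closed[OF gen_verts.range[OF assms]] by blast
  show ?thesis
    unfolding pm.subspace_def
  proof (intro conjI ballI allI)
    show "0 \<in> s e ` ?U"
      using imageI[OF pm.subspace_0[OF sub], of "s e"] by (simp only: s_zero[OF assms])
    show "x + y \<in> s e ` ?U" if xy: "x \<in> s e ` ?U" "y \<in> s e ` ?U" for x y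
    proof -
      obtain a where a: "x = s e a" "a \<in> ?U" using xy(1) by (rule imageE)
      obtain b where b: "y = s e b" "b \<in> ?U" using xy(2) by (rule imageE)
      have "x + y = s e (a + b)"
        using a b UV s_add[OF assms] by (simp add: subset_iff)
      then show ?thesis
        using imageI[OF pm.subspace_add[OF sub a(2) b(2)], of "s e"] by (simp only:)
    qed
    show "pm_scale c x \<in> s e ` ?U" if x: "x \<in> s e ` ?U" for c x
    proof -
      obtain a where a: "x = s e a" "a \<in> ?U" using x by (rule imageE)
      have "pm_scale c x = s e (pm_scale c a)"
        using a UV s_scale[OF assms] by (simp add: subset_iff)
      then show ?thesis
        using imageI[OF pm.subspace_scale[OF sub a(2)], of "s e"] by (simp only:)
    qed
  qed
qed

text \<open>On the image of \<open>p (rng G e)\<close> the linear map \<open>t e\<close> inverts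
  \<open>s e\<close> from the left, so \<open>s e\<close> carries a basis to an independent
  family.\<close>

lemma dim_s_image:
  assumes "e \<in> edges G"
  shows "pm.dim (p (rng G e) ` V) \<le> pm.dim (s e ` (p (rng G e) ` V))"
proof -
  let ?U = "p (rng G e) ` V"
  have ts: "t e (s e z) = z" "z \<in> V" if "z \<in> ?U" for z
    using p_image_fixed[OF gen_verts.range[OF assms] that] t_s[OF assms assms] by auto
  obtain B where B: "B \<subseteq> ?U" "pm.independent B" "card B = pm.dim ?U"
    using pm.basis_exists by blast
  have inj: "inj_on (s e) B"
    using ts B(1) by (metis inj_onI subsetD)
  \<comment> \<open>Membership in \<open>V\<close> is part of the claim because \<open>t e\<close>
    is known to be linear only on \<open>V\<close>.\<close>
  have "t e z \<in> pm.span C \<and> z \<in> V" if "C \<subseteq> ?U" "z \<in> pm.span (s e ` C)" for z C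
    using that(2)
  proof (induction z rule: pm.span_induct_alt)
    case base
    show ?case using t_zero[OF assms] zero_V pm.span_zero by simp
  next
    case (step c x z)
    then obtain a where a: "a \<in> C" "x = s e a" by blast
    then have "x \<in> V" "t e x = a" using ts[of a] that(1) s_closed[OF assms] by auto
    then show ?case
      using step a(1) pm.subspace_add[OF subspace_V] pm.subspace_scale[OF subspace_V]
      by (simp add: t_add[OF assms] t_scale[OF assms] pm.span_add pm.span_scale pm.span_base)
  qed
  note t_span = this
  have "pm.independent (s e ` B)"
    unfolding pm.dependent_def
  proof
    assume "\<exists>a \<in> s e ` B. a \<in> pm.span (s e ` B - {a})"
    then obtain b where b: "b \<in> B" "s e b \<in> pm.span (s e ` B - {s e b})" by blast
    have "s e ` B - {s e b} \<subseteq> s e ` (B - {b})" by blast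
    then have "s e b \<in> pm.span (s e ` (B - {b}))"
      using b(2) pm.span_mono by blast
    then have "t e (s e b) \<in> pm.span (B - {b})"
      using t_span[of "B - {b}"] B(1) by blast
    then show False
      using B(1,2) b(1) ts[of b] by (auto simp: pm.dependent_def)
  qed
  moreover have "s e ` B \<subseteq> s e ` ?U" using B(1) by blast
  moreover have "s e ` ?U \<subseteq> pm.span F"
    using ts(2) s_closed[OF assms] V_eq by blast
  ultimately show ?thesis
    using pm.independent_card_le_dim_of_finite_span[OF _ _ _ finite_F] card_image[OF inj] B(3)
    by metis
qed

text \<open>The map \<open>s e\<close> embeds the image of \<open>p (rng G e)\<close> into that of
  \<open>p {src G e}\<close>. When the dimensions agree the embedding is onto, and
  \<open>s e\<close> after \<open>t e\<close> is the identity on the target.\<close>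

lemma dim_edge_le:
  assumes "e \<in> edges G"
  shows "pm.dim (p (rng G e) ` V) \<le> pm.dim (p {src G e} ` V)"
    and "pm.dim (p {src G e} ` V) \<le> pm.dim (p (rng G e) ` V) \<Longrightarrow>
      x \<in> V \<Longrightarrow> s e (t e (p {src G e} x)) = p {src G e} x"
proof -
  let ?U = "p (rng G e) ` V" and ?W = "p {src G e} ` V"
  obtain B where B: "B \<subseteq> s e ` ?U" "pm.independent B" "card B = pm.dim (s e ` ?U)"
    using pm.basis_exists by blast
  have W: "?W \<subseteq> pm.span F"
    using p_closed[OF src_gen[OF assms]] V_eq by blast
  have "B \<subseteq> ?W" using B(1) s_image[OF assms] by (rule subset_trans)
  then have "pm.dim (s e ` ?U) \<le> pm.dim ?W"
    using pm.independent_card_le_dim_of_finite_span[OF B(2) _ W finite_F] B(3) by simp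
  then show "pm.dim ?U \<le> pm.dim ?W"
    using dim_s_image[OF assms] by linarith
  assume le: "pm.dim ?W \<le> pm.dim ?U" and x: "x \<in> V"
  have "s e ` ?U = ?W"
    using pm.subspace_eq_if_dim_le[OF subspace_s_image[OF assms] s_image[OF assms] W finite_F]
      le dim_s_image[OF assms] by linarith
  then obtain z where z: "z \<in> ?U" "p {src G e} x = s e z"
    using x by blast
  have "z \<in> V" "p (rng G e) z = z"
    using p_image_fixed[OF gen_verts.range[OF assms] z(1)] by auto
  then show "s e (t e (p {src G e} x)) = p {src G e} x"
    using z(2) t_s[OF assms assms] by simp
qed

end

section \<open>Walks, cycles and exits\<close>

text \<open>Cyclic indexing absorbs the closing condition: for the last edge,
  \<open>Suc i mod length c\<close> is 0.\<close>

lemma cycle_next: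
  assumes "is_cycle G c" "i < length c"
  shows "c ! i \<in> edges G" "src G (c ! (Suc i mod length c)) \<in> rng G (c ! i)"
proof -
  have c: "c \<noteq> []" "set c \<subseteq> edges G" "src G (hd c) \<in> rng G (last c)"
    "\<And>i. Suc i < length c \<Longrightarrow> src G (c ! Suc i) \<in> rng G (c ! i)"
    using assms(1) by (auto simp: is_cycle_def is_path_def)
  show "c ! i \<in> edges G"
    using c(2) assms(2) by auto
  show "src G (c ! (Suc i mod length c)) \<in> rng G (c ! i)"
  proof (cases "Suc i < length c")
    case True
    then show ?thesis using c(4) by simp
  next
    case False
    then have "Suc i = length c" "i = length c - 1" using assms(2) by auto
    then show ?thesis using c(1,3) by (simp add: hd_conv_nth last_conv_nth)
  qed
qed

text \<open>By pigeonhole some source repeats. Between two equal sources at the least possible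
  distance all sources are distinct, so that segment is a cycle.\<close>

lemma finite_walk_meets_cycle:
  assumes "\<And>i. e i \<in> edges G" "\<And>i. src G (e (Suc i)) \<in> rng G (e i)" "finite (range e)"
  shows "\<exists>i. on_cycle G (src G (e i))"
proof -
  define v where "v i = src G (e i)" for i :: nat
  have "\<not> inj e"
    using assms(3) finite_imageD infinite_UNIV_nat by blast
  then obtain a b where "a < b" "v a = v b"
    unfolding inj_on_def v_def by (metis linorder_neqE_nat)
  then have ex: "\<exists>d. 0 < d \<and> (\<exists>i. v i = v (i + d))"
    by (metis less_imp_add_positive)
  \<comment> \<open>The minimum ranges over all starting points, so every window of length
    \<open>d\<close> is free of repetitions, not only the one at \<open>i\<close>.\<close>
  define d where "d = (LEAST d. 0 < d \<and> (\<exists>i. v i = v (i + d)))"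
  obtain i where d: "0 < d" "v i = v (i + d)"
    using LeastI_ex[OF ex] unfolding d_def by blast
  have min: "v j \<noteq> v k" if "j < k" "k < j + d" for j k
  proof
    assume "v j = v k"
    then have "0 < k - j \<and> (\<exists>i. v i = v (i + (k - j)))"
      using that by (auto intro: exI[of _ j])
    then have "d \<le> k - j"
      unfolding d_def by (rule Least_le)
    then show False using that by simp
  qed
  define c where "c = map e [i..<i + d]"
  have len: "length c = d" and nth: "\<And>k. k < d \<Longrightarrow> c ! k = e (i + k)"
    by (simp_all add: c_def)
  have ne: "c \<noteq> []" using len d(1) by auto
  have "is_path G c"
    using ne assms(1,2) by (auto simp: is_path_def len nth c_def)
  \<comment> \<open>The last edge has offset \<open>d - 1\<close>, and its range contains
    \<open>v (i + d)\<close>, which equals \<open>v i\<close>.\<close>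
  moreover have "src G (hd c) \<in> rng G (last c)"
    using ne d assms(2)[of "i + (d - 1)"] by (simp add: hd_conv_nth last_conv_nth len nth v_def)
  moreover have "distinct (map (src G) c)"
  proof -
    have "v (i + j) \<noteq> v (i + k)" if "j < d" "k < d" "j \<noteq> k" for j k
      using that min[of "i + j" "i + k"] min[of "i + k" "i + j"] by (cases "j < k") fastforce+
    then show ?thesis
      by (simp add: distinct_conv_nth len nth v_def)
  qed
  ultimately have "is_cycle G c" by (simp add: is_cycle_def)
  moreover have "src G (e i) \<in> src G ` set c" using d(1) by (simp add: c_def)
  ultimately show ?thesis
    unfolding on_cycle_def by blast
qed

lemma is_path_single: "e \<in> edges G \<Longrightarrow> is_path G [e]"
  by (simp add: is_path_def)

lemma is_path_Cons:
  assumes "is_path G \<alpha>" "e \<in> edges G" "src G (hd \<alpha>) \<in> rng G e"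
  shows "is_path G (e # \<alpha>)"
  using assms by (auto simp: is_path_def nth_Cons hd_conv_nth split: nat.split)

text \<open>Used in contrapositive form: failing to reach a terminal boundary set is inherited by
  every vertex in the range of an emitted edge.\<close>

lemma reaches_terminal_step:
  assumes "e \<in> edges G" "w \<in> rng G e" "reaches_terminal G w"
  shows "reaches_terminal G (src G e)"
  using assms(3) unfolding reaches_terminal_def[of G w]
proof (elim disjE exE conjE bexE)
  assume "{w} \<in> terminal_boundary G"
  then show ?thesis
    using assms(2) is_path_single[OF assms(1)] unfolding reaches_terminal_def
    by (intro disjI2 exI[of _ "[e]"]) auto
next
  fix \<alpha> A assume \<alpha>: "is_path G \<alpha>" "src G (hd \<alpha>) = w" "A \<in> terminal_boundary G" "A \<subseteq> rng G (last \<alpha>)"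
  then have "is_path G (e # \<alpha>)"
    using is_path_Cons assms(1,2) by metis
  moreover have "\<alpha> \<noteq> []"
    using \<alpha>(1) by (simp add: is_path_def)
  ultimately show ?thesis
    using \<alpha> unfolding reaches_terminal_def by (intro disjI2 exI[of _ "e # \<alpha>"]) auto
qed

lemma reaches_cycle_step:
  assumes "e \<in> edges G" "w \<in> rng G e" "reaches_cycle G w"
  shows "reaches_cycle G (src G e)"
  using assms(3) unfolding reaches_cycle_def[of G w]
proof (elim disjE exE conjE bexE)
  assume "on_cycle G w"
  then show ?thesis
    using assms(2) is_path_single[OF assms(1)] unfolding reaches_cycle_def
    by (intro disjI2 exI[of _ "[e]"]) auto
next
  fix \<alpha> u assume \<alpha>: "is_path G \<alpha>" "src G (hd \<alpha>) = w" "u \<in> rng G (last \<alpha>)" "on_cycle G u"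
  then have "is_path G (e # \<alpha>)"
    using is_path_Cons assms(1,2) by metis
  moreover have "\<alpha> \<noteq> []"
    using \<alpha>(1) by (simp add: is_path_def)
  ultimately show ?thesis
    using \<alpha> unfolding reaches_cycle_def by (intro disjI2 exI[of _ "e # \<alpha>"]) auto
qed

text \<open>A vertex emitting infinitely many edges is a minimal infinite emitter, because its only
  proper subset is empty.\<close>

lemma regular_if_not_reaches_terminal:
  assumes "v \<in> verts G" "\<not> reaches_terminal G v"
  shows "is_regular G v"
proof -
  have nt: "{v} \<notin> terminal_boundary G"
    using assms(2) by (simp add: reaches_terminal_def)
  have "minimal_infinite_emitter G {v}" if "infinite {e \<in> edges G. src G e = v}"
  proof -
    have empty: "B = {}" if "B \<subset> {v}" for B using that by blast
    show ?thesis
      unfolding minimal_infinite_emitter_def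
      using that assms(1)
      by (auto simp: infinite_emitter_def emitted_def intro: gen_verts.singleton dest!: empty)
  qed
  then have "finite {e \<in> edges G. src G e = v}"
    using nt by (auto simp: terminal_boundary_def)
  moreover have "\<not> is_sink G v"
    using nt by (auto simp: terminal_boundary_def)
  ultimately show ?thesis
    using assms(1) by (simp add: is_regular_def is_sink_def)
qed

text \<open>A terminal boundary set among the pieces given by \<open>RFUM2\<close> would be reached
  by the path \<open>[e]\<close>. The remaining pieces are singletons.\<close>

lemma finite_rng_if_not_reaches_terminal:
  assumes "RFUM2 G" "e \<in> edges G" "\<not> reaches_terminal G (src G e)"
  shows "finite (rng G e)"
proof -
  obtain \<F> where \<F>: "finite \<F>" "rng G e = \<Union>\<F>"
    "\<And>A. A \<in> \<F> \<Longrightarrow> minimal_infinite_emitter G A \<or> minimal_sink G A \<or>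
        (\<exists>v. A = {v} \<and> (is_sink G v \<or> is_regular G v))"
    using assms(1,2) unfolding RFUM2_def by meson
  have "finite A" if "A \<in> \<F>" for A
  proof -
    have "A \<subseteq> rng G e" using \<F>(2) that by blast
    then have "A \<notin> terminal_boundary G"
      using assms(3) is_path_single[OF assms(2)] unfolding reaches_terminal_def
      by (metis last.simps list.sel(1))
    then show ?thesis using \<F>(3)[OF that] by (auto simp: terminal_boundary_def)
  qed
  then show ?thesis using \<F>(1,2) by simp
qed

context fin_dim_rep
begin

text \<open>Going once around a cycle the dimensions of the corners can only decrease, so they are all
  equal.\<close>

lemma cycle_dim:
  assumes "is_cycle G c" "i < length c"
  shows "pm.dim (p {src G (c ! i)} ` V) \<le> pm.dim (p {src G (c ! (Suc i mod length c))} ` V)"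
proof -
  define n where "n = length c"
  \<comment> \<open>Dimensions along the cycle, unrolled to a sequence of period
    \<open>n\<close>.\<close>
  define a where "a k = pm.dim (p {src G (c ! (k mod n))} ` V)" for k
  have n: "0 < n" "i < n" using assms(2) by (auto simp: n_def)
  have a_Suc: "a (Suc k) \<le> a k" for k
  proof -
    have k: "k mod n < length c" using n by (simp add: n_def)
    note e = cycle_next[OF assms(1) k]
    have eq: "Suc (k mod n) mod length c = Suc k mod n"
      by (simp add: n_def mod_Suc_eq)
    have "a (Suc k) \<le> pm.dim (p (rng G (c ! (k mod n))) ` V)"
      unfolding a_def using e eq
      by (intro dim_p_mono gen_verts.range in_rng_gen[OF e(1)]) auto
    also have "\<dots> \<le> a k"
      unfolding a_def by (rule dim_edge_le(1)[OF e(1)])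
    finally show ?thesis .
  qed
  \<comment> \<open>The left side equals \<open>a i\<close> by periodicity, which gives the reverse
    of \<open>a_Suc\<close>.\<close>
  have "a (i + n) \<le> a (Suc i)"
    using n by (intro lift_Suc_antimono_le[where f = a, OF a_Suc]) simp
  then show ?thesis
    using n by (simp add: a_def n_def)
qed

text \<open>The image of the projection at the next cycle vertex lies in that of
  \<open>p (rng G (c ! i))\<close> and has at least its dimension, so the two agree. The projection
  at any other vertex \<open>w\<close> of the range is orthogonal to the former, yet has its image
  in the latter.\<close>

lemma cycle_exit_vertex_zero:
  assumes "is_cycle G c" "i < length c" "w \<in> rng G (c ! i)"
    "w \<noteq> src G (c ! (Suc i mod length c))" "x \<in> V"
  shows "p {w} x = 0"
proof -
  let ?e = "c ! i" and ?v = "src G (c ! (Suc i mod length c))"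
  note e = cycle_next[OF assms(1,2)]
  have gens: "{?v} \<in> gen_verts G" "rng G ?e \<in> gen_verts G" "{w} \<in> gen_verts G"
    using in_rng_gen[OF e(1)] e assms(3) gen_verts.range[OF e(1)] by simp_all
  have dim: "pm.dim (p (rng G ?e) ` V) \<le> pm.dim (p {?v} ` V)"
    using dim_edge_le(1)[OF e(1)] cycle_dim[OF assms(1,2)] by linarith
  have span: "p (rng G ?e) ` V \<subseteq> pm.span F"
    using p_closed[OF gens(2)] V_eq by blast
  have "p {?v} ` V \<subseteq> p (rng G ?e) ` V"
    using e(2) by (intro p_image_mono gens) simp
  then have eq: "p {?v} ` V = p (rng G ?e) ` V"
    by (rule pm.subspace_eq_if_dim_le[OF subspace_p[OF gens(1)] _ span finite_F dim])
  have "p {w} ` V \<subseteq> p (rng G ?e) ` V"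
    using assms(3) by (intro p_image_mono gens) simp
  then have "p {w} x \<in> p {?v} ` V"
    unfolding eq by (rule subsetD) (rule imageI[OF assms(5)])
  then have "p {w} x = p {?v} (p {w} x)"
    using p_image_fixed[OF gens(1)] by metis
  also have "\<dots> = p ({?v} \<inter> {w}) x"
    by (rule p_inter[OF gens(1,3) assms(5)])
  also have "{?v} \<inter> {w} = {}"
    using assms(4) by blast
  also have "p {} x = 0"
    by (rule p_empty[OF assms(5)])
  finally show ?thesis .
qed

text \<open>Equal dimensions make \<open>s\<close> after \<open>t\<close> for the cycle edge the
  identity on the image of the projection at its source. This image contains \<open>s f x\<close>,
  which the cycle edge's \<open>t\<close> kills.\<close>

lemma cycle_exit_edge_zero:
  assumes "is_cycle G c" "i < length c" "f \<in> edges G" "src G f = src G (c ! i)" "f \<noteq> c ! i"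
    "x \<in> V"
  shows "s f x = 0"
proof -
  let ?e = "c ! i"
  note e = cycle_next[OF assms(1,2)]
  have "pm.dim (p {src G (c ! (Suc i mod length c))} ` V) \<le> pm.dim (p (rng G ?e) ` V)"
    using e by (intro dim_p_mono in_rng_gen[OF e] gen_verts.range) auto
  then have "pm.dim (p {src G ?e} ` V) \<le> pm.dim (p (rng G ?e) ` V)"
    using cycle_dim[OF assms(1,2)] by linarith
  then have "s ?e (t ?e (p {src G ?e} (s f x))) = p {src G ?e} (s f x)"
    using dim_edge_le(2)[OF e(1)] s_closed[OF assms(3,6)] by blast
  moreover have "p {src G ?e} (s f x) = s f x"
    using p_s[OF assms(3,6)] assms(4) by simp
  moreover have "t ?e (s f x) = 0"
    using t_s[OF e(1) assms(3,6)] assms(5) by simp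
  ultimately show ?thesis using s_zero[OF e(1)] by simp
qed

text \<open>Here \<open>v\<close> is regular, so some summand \<open>s e (t e x)\<close> of
  \<open>p {v} x\<close> is nonzero. Then \<open>t e x\<close> is a nonzero vector fixed by
  \<open>p (rng G e)\<close>, and finiteness of the range passes this on to a single vertex.\<close>

lemma nonzero_forward:
  assumes "RFUM2 G" "v \<in> verts G" "\<not> reaches_terminal G v" "\<exists>x \<in> V. p {v} x \<noteq> 0"
  shows "\<exists>e w. e \<in> edges G \<and> src G e = v \<and> (\<exists>x \<in> V. s e x \<noteq> 0) \<and> w \<in> rng G e \<and>
    (\<exists>x \<in> V. p {w} x \<noteq> 0)"
proof -
  obtain x where x: "x \<in> V" "p {v} x \<noteq> 0" using assms(4) by blast
  have "(\<Sum>e \<in> {e \<in> edges G. src G e = v}. s e (t e x)) \<noteq> 0"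
    using p_regular[OF regular_if_not_reaches_terminal[OF assms(2,3)] x(1)] x(2) by simp
  then obtain e where e: "e \<in> edges G" "src G e = v" "s e (t e x) \<noteq> 0"
    by (elim sum.not_neutral_contains_not_neutral) blast
  have tV: "t e x \<in> V" by (rule t_closed[OF e(1) x(1)])
  have "p (rng G e) (t e x) \<noteq> 0"
    using p_t[OF e(1) x(1)] s_zero[OF e(1)] e(3) by auto
  moreover have "finite (rng G e)"
    using finite_rng_if_not_reaches_terminal[OF assms(1) e(1)] e(2) assms(3) by simp
  ultimately obtain w where "w \<in> rng G e" "p {w} (t e x) \<noteq> 0"
    using nonzero_vertex_of_finite_set[OF _ rng_sub[OF e(1)] tV] by blast
  then show ?thesis using e tV by blast
qed

text \<open>Otherwise \<open>nonzero_forward\<close> can be iterated forever; only finitely many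
  edges act nontrivially, so the walk meets a cycle.\<close>

lemma reaches_if_nonzero:
  assumes "RFUM2 G" "v \<in> verts G" "\<exists>x \<in> V. p {v} x \<noteq> 0"
  shows "reaches_terminal G v \<or> reaches_cycle G v"
proof (rule ccontr)
  assume nr: "\<not> (reaches_terminal G v \<or> reaches_cycle G v)"
  define bad where "bad w \<longleftrightarrow> w \<in> verts G \<and> \<not> (reaches_terminal G w \<or> reaches_cycle G w) \<and>
    (\<exists>x \<in> V. p {w} x \<noteq> 0)" for w
  \<comment> \<open>Nonvanishing of \<open>s e\<close> is recorded so that all edges of the walk lie
    in the set of \<open>finite_nonzero_edges\<close>.\<close>
  define step where "step w e u \<longleftrightarrow> e \<in> edges G \<and> src G e = w \<and> u \<in> rng G e \<and> (\<exists>x \<in> V. s e x \<noteq> 0)"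
    for w e u
  have next_bad: "\<exists>u. bad u \<and> (\<exists>e. step w e u)" if w: "bad w" for w
  proof -
    obtain e u where e: "e \<in> edges G" "src G e = w" "\<exists>x \<in> V. s e x \<noteq> 0"
      and u: "u \<in> rng G e" "\<exists>x \<in> V. p {u} x \<noteq> 0"
      using nonzero_forward[OF assms(1), of w] w unfolding bad_def by blast
    have "bad u"
      using w u e reaches_terminal_step[OF e(1) u(1)] reaches_cycle_step[OF e(1) u(1)]
        rng_sub[OF e(1)] unfolding bad_def by blast
    then show ?thesis using e u unfolding step_def by blast
  qed
  have "bad v" using nr assms by (simp add: bad_def)
  then obtain w where w: "\<And>n. bad (w n)" "\<And>n. \<exists>e. step (w n) e (w (Suc n))"
    using dependent_nat_choice[of "\<lambda>_. bad" "\<lambda>_ w u. \<exists>e. step w e u"] next_bad by metis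
  then obtain e where e: "\<And>n. step (w n) (e n) (w (Suc n))" by metis
  have "range e \<subseteq> {e \<in> edges G. \<exists>x \<in> V. s e x \<noteq> 0}"
    using e unfolding step_def by blast
  then have "finite (range e)"
    using finite_nonzero_edges by (rule finite_subset)
  moreover have "e i \<in> edges G" "src G (e (Suc i)) \<in> rng G (e i)" for i
    using e[of i] e[of "Suc i"] by (auto simp: step_def)
  ultimately obtain i where "on_cycle G (src G (e i))"
    using finite_walk_meets_cycle by metis
  then have "reaches_cycle G (w i)"
    using e[of i] by (simp add: step_def reaches_cycle_def)
  then show False using w(1)[of i] by (simp add: bad_def)
qed

end

section \<open>Representations from homomorphisms\<close>

lemma \<iota>_free_carrier: "g \<in> gens G \<Longrightarrow> \<iota> g \<in> free_carrier G"
  by (simp add: \<iota>_def free_carrier_def)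

lemma gens_simps [simp]:
  "P A \<in> gens G \<longleftrightarrow> A \<in> gen_verts G"
  "S e \<in> gens G \<longleftrightarrow> e \<in> edges G"
  "Sstar e \<in> gens G \<longleftrightarrow> e \<in> edges G"
  by (auto simp: gens_def)

text \<open>Relators vanish in the quotient, so the images of the generators satisfy the defining
  relations; these are evaluated pointwise on the span of \<open>F\<close>.\<close>

lemma fin_dim_rep_of_hom:
  fixes G :: "('v, 'e) ultragraph" and F :: "('b \<Rightarrow>\<^sub>0 'k::field) set"
    and \<pi> :: "('v, 'e, 'k) free_alg set \<Rightarrow> ('b \<Rightarrow>\<^sub>0 'k) \<Rightarrow> ('b \<Rightarrow>\<^sub>0 'k)"
  assumes "ultragraph G" "finite F" "\<pi> \<in> kalg_hom (leavitt_path_algebra G) (End (pm.span F))"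
  shows "fin_dim_rep G (pm.span F) F (\<lambda>A. \<pi> (lpa_class G (\<iota> (P A))))
    (\<lambda>e. \<pi> (lpa_class G (\<iota> (S e)))) (\<lambda>e. \<pi> (lpa_class G (\<iota> (Sstar e))))"
proof -
  interpret ultragraph G by fact
  let ?V = "pm.span F"
  define R where "R x = \<pi> (lpa_class G x)" for x
  note hom = assms(3)[unfolded kalg_hom_def mem_Collect_eq]
  have class_carr: "lpa_class G x \<in> carr (leavitt_path_algebra G)" if "x \<in> free_carrier G"
    for x :: "('v, 'e, 'k) free_alg"
    using that by (simp add: leavitt_path_algebra_def)
  have R_carr: "R x \<in> carr (End ?V)" if "x \<in> free_carrier G" for x
    using hom class_carr[OF that] unfolding R_def by blast
  have closed: "R x v \<in> ?V" if "x \<in> free_carrier G" "v \<in> ?V" for x v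
    using R_carr[OF that(1)] that(2) by (auto simp: End_def)
  have R_lin_add: "R x (v + w) = R x v + R x w"
    if "x \<in> free_carrier G" "v \<in> ?V" "w \<in> ?V" for x v w
    using R_carr[OF that(1)] that(2,3) by (simp add: End_def)
  have R_lin_scale: "R x (pm_scale c v) = pm_scale c (R x v)"
    if "x \<in> free_carrier G" "v \<in> ?V" for x v c
    using R_carr[OF that(1)] that(2) by (simp add: End_def)
  have R_add: "R (x + y) v = R x v + R y v"
    if "x \<in> free_carrier G" "y \<in> free_carrier G" "v \<in> ?V" for x y v
  proof -
    have "R (x + y) = add (End ?V) (R x) (R y)"
      using hom class_carr that(1,2) unfolding R_def by (simp flip: lpa_add)
    then show ?thesis using that(3) by (simp add: End_def)
  qed
  have R_mult: "R (x * y) v = R x (R y v)"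
    if "x \<in> free_carrier G" "y \<in> free_carrier G" "v \<in> ?V" for x y v
  proof -
    have "R (x * y) = mul (End ?V) (R x) (R y)"
      using hom class_carr that(1,2) unfolding R_def by (simp flip: lpa_mul)
    then show ?thesis using that(3) by (simp add: End_def compose_def)
  qed
  have R_0: "R 0 v = 0" if "v \<in> ?V" for v
    using R_add[OF free_carrier_0 free_carrier_0 that] by simp
  have R_diff: "R (x - y) v = R x v - R y v"
    if "x \<in> free_carrier G" "y \<in> free_carrier G" "v \<in> ?V" for x y v
  proof -
    have "x - y \<in> free_carrier G"
      using free_carrier_add[OF that(1) free_carrier_scale[OF that(2), of "- 1"]]
      by simp
    then show ?thesis
      using R_add[of "x - y" y v] that by (simp add: algebra_simps)
  qed
  have R_sum: "R (\<Sum>i \<in> I. x i) v = (\<Sum>i \<in> I. R (x i) v) \<and> (\<Sum>i \<in> I. x i) \<in> free_carrier G"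
    if "finite I" "\<And>i. i \<in> I \<Longrightarrow> x i \<in> free_carrier G" "v \<in> ?V"
    for I :: "'e set" and x v
    using that by (induction I rule: finite_induct) (simp_all add: R_0 R_add free_carrier_0 free_carrier_add)
  have R_rel: "R x = R y" if "x - y \<in> relators G" for x y
    unfolding R_def using relator_ideal.relator[OF that] by (simp add: lpa_class_cong)
  have fc: "A \<in> gen_verts G \<Longrightarrow> \<iota> (P A) \<in> free_carrier G"
    "e \<in> edges G \<Longrightarrow> \<iota> (S e) \<in> free_carrier G" "e \<in> edges G \<Longrightarrow> \<iota> (Sstar e) \<in> free_carrier G"
    for A e
    by (simp_all add: \<iota>_free_carrier)
  note gen = gen_verts.empty gen_verts.singleton gen_verts.range gen_verts.inter gen_verts.union
    src_in
  note app = R_mult[symmetric] fc gen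
  show ?thesis
    unfolding R_def[symmetric]
  proof (unfold_locales, goal_cases)
    case 1 show ?case by fact
  next
    case 2 show ?case by (rule refl)
  next
    case 3 then show ?case by (simp add: closed fc)
  next
    case 4 then show ?case by (simp add: closed fc)
  next
    case 5 then show ?case by (simp add: closed fc)
  next
    case 6 then show ?case by (simp add: R_lin_add fc)
  next
    case 7 then show ?case by (simp add: R_lin_add fc)
  next
    case 8 then show ?case by (simp add: R_lin_add fc)
  next
    case 9 then show ?case by (simp add: R_lin_scale fc)
  next
    case 10 then show ?case by (simp add: R_lin_scale fc)
  next
    case 11 then show ?case by (simp add: R_lin_scale fc)
  next
    case 12 then show ?case
      using R_rel[of "\<iota> (P {})" 0] by (simp add: relators.p_empty R_0)
  next
    case 13 then show ?case
      using R_rel[OF relators.p_inter] by (simp add: app)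
  next
    case (14 A B v)
    then have "R (\<iota> (P (A \<union> B))) v = R (\<iota> (P A) + \<iota> (P B) - \<iota> (P (A \<inter> B))) v"
      using R_rel[OF relators.p_union] by simp
    with 14 show ?case
      by (simp add: R_diff R_add free_carrier_add fc gen)
  next
    case 15 then show ?case
      using R_rel[OF relators.src_s] by (simp add: app)
  next
    case 16 then show ?case
      using R_rel[OF relators.s_rng] by (simp add: app)
  next
    case 17 then show ?case
      using R_rel[OF relators.rng_sstar] by (simp add: app)
  next
    case (18 e f v) then show ?case
      using R_rel[OF relators.sstar_s[OF 18(1,2)]] by (simp add: app R_0)
  next
    case (19 u v)
    let ?E = "{e \<in> edges G. src G e = u}"
    have fin: "finite ?E" using 19(1) by (simp add: is_regular_def)
    have "R (\<iota> (P {u})) v = R (\<Sum>e \<in> ?E. \<iota> (S e) * \<iota> (Sstar e)) v"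
      using R_rel[OF relators.regular[OF 19(1)]] by simp
    also have "\<dots> = (\<Sum>e \<in> ?E. R (\<iota> (S e) * \<iota> (Sstar e)) v)"
      using R_sum[OF fin _ 19(2)] by (simp add: free_carrier_mult fc)
    also have "\<dots> = (\<Sum>e \<in> ?E. R (\<iota> (S e)) (R (\<iota> (Sstar e)) v))"
      using 19(2) by (intro sum.cong) (simp_all add: R_mult fc)
    finally show ?case .
  qed
qed

text \<open>The class of \<open>\<iota> (P {v})\<close> is nonzero, so residual
  finite-dimensionality applies to it. Elements of \<open>End V\<close> are extensional, so a
  nonzero one is nonzero at some point of \<open>V\<close>.\<close>

lemma rep_nonzero_at:
  fixes G :: "('v, 'e) ultragraph"
  assumes "ultragraph G"
    and "residually_finite_dimensional
      (leavitt_path_algebra G :: ('k::field, ('v, 'e, 'k) free_alg set) kalg)"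
    and "v \<in> verts G" "(\<iota> (P {v}) :: ('v, 'e, 'k) free_alg) \<notin> relator_ideal G"
  obtains V F :: "(nat \<Rightarrow>\<^sub>0 'k::field) set" and p s t x
  where "fin_dim_rep G V F p s t" "x \<in> V" "p {v} x \<noteq> 0"
proof -
  let ?L = "leavitt_path_algebra G :: ('k, ('v, 'e, 'k) free_alg set) kalg"
  let ?a = "lpa_class G (\<iota> (P {v})) :: ('v, 'e, 'k) free_alg set"
  have fc: "(\<iota> (P {v}) :: ('v, 'e, 'k) free_alg) \<in> free_carrier G"
    using assms(3) by (simp add: \<iota>_free_carrier gen_verts.singleton)
  have a: "?a \<in> carr ?L" "?a \<noteq> zer ?L"
    using fc assms(4) by (auto simp: leavitt_path_algebra_def lpa_class_eq_iff)
  then obtain V :: "(nat \<Rightarrow>\<^sub>0 'k) set" and \<pi>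
    where V: "fin_dim_space V" "\<pi> \<in> kalg_hom ?L (End V)" "\<pi> ?a \<noteq> zer (End V)"
    using assms(2) unfolding residually_finite_dimensional_def by blast
  obtain F where F: "finite F" "V = pm.span F"
    using V(1) unfolding fin_dim_space_def by blast
  have "\<pi> ?a \<in> carr (End V)"
    using V(2) a(1) unfolding kalg_hom_def by blast
  then have "\<pi> ?a \<in> V \<rightarrow>\<^sub>E V" by (simp add: End_def)
  moreover have "zer (End V) \<in> extensional V" by (simp add: End_def)
  ultimately obtain x where x: "x \<in> V" "\<pi> ?a x \<noteq> zer (End V) x"
    using V(3) extensionalityI[of "\<pi> ?a" V "zer (End V)"] by (auto simp: PiE_def)
  then have "\<pi> ?a x \<noteq> 0" by (simp add: End_def)
  with x(1) show ?thesis
    using that fin_dim_rep_of_hom[OF assms(1) F(1) V(2)[unfolded F(2)]] F(2) by blast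
qed

section \<open>Nonvanishing of the vertex projections\<close>

definition word_action :: "('g \<Rightarrow> ('x \<Rightarrow> 'k) \<Rightarrow> ('x \<Rightarrow> 'k)) \<Rightarrow> 'g word \<Rightarrow> ('x \<Rightarrow> 'k) \<Rightarrow> ('x \<Rightarrow> 'k)"
  where "word_action T w = foldr T (letters w)"

definition free_action ::
    "('g \<Rightarrow> ('x \<Rightarrow> 'k) \<Rightarrow> ('x \<Rightarrow> 'k)) \<Rightarrow> ('g word \<Rightarrow>\<^sub>0 'k::field) \<Rightarrow> ('x \<Rightarrow> 'k) \<Rightarrow> ('x \<Rightarrow> 'k)" where
  "free_action T a f = (\<lambda>x. \<Sum>w \<in> Poly_Mapping.keys a. Poly_Mapping.lookup a w * word_action T w f x)"

lemma poly_mapping_add_single_induct [case_names zero add]: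
  assumes "Q 0" "\<And>w c a. Q a \<Longrightarrow> Q (Poly_Mapping.single w c + a)"
  shows "Q (a :: 'y \<Rightarrow>\<^sub>0 'k::monoid_add)"
proof (induction a rule: update_induct)
  case const
  show ?case by (rule assms(1))
next
  case (update f a b)
  have "Poly_Mapping.update a b f = Poly_Mapping.single a b + f"
    using update.hyps
    by (intro poly_mapping_eqI)
      (auto simp: lookup_update lookup_add lookup_single in_keys_iff when_def)
  then show ?case using assms(2)[OF update.IH] by simp
qed

locale linear_operators =
  fixes T :: "'g \<Rightarrow> ('x \<Rightarrow> 'k::field) \<Rightarrow> ('x \<Rightarrow> 'k)"
  assumes T_add: "T g (\<lambda>x. f x + h x) = (\<lambda>x. T g f x + T g h x)"
    and T_scale: "T g (\<lambda>x. c * f x) = (\<lambda>x. c * T g f x)"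
begin

lemma word_action_add:
  "word_action T w (\<lambda>x. f x + h x) = (\<lambda>x. word_action T w f x + word_action T w h x)"
proof -
  have "foldr T l (\<lambda>x. f x + h x) = (\<lambda>x. foldr T l f x + foldr T l h x)" for l
    by (induction l) (simp_all add: T_add)
  then show ?thesis by (simp add: word_action_def)
qed

lemma word_action_scale: "word_action T w (\<lambda>x. c * f x) = (\<lambda>x. c * word_action T w f x)"
proof -
  have "foldr T l (\<lambda>x. c * f x) = (\<lambda>x. c * foldr T l f x)" for l
    by (induction l) (simp_all add: T_scale)
  then show ?thesis by (simp add: word_action_def)
qed

lemma word_action_zero: "word_action T w (\<lambda>x. 0) = (\<lambda>x. 0)"
  using word_action_scale[of w 0 "\<lambda>x. 0"] by simp

lemma free_action_superset:
  "finite W \<Longrightarrow> Poly_Mapping.keys a \<subseteq> W \<Longrightarrow>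
    free_action T a f x = (\<Sum>w \<in> W. Poly_Mapping.lookup a w * word_action T w f x)"
  unfolding free_action_def by (rule sum.mono_neutral_left) (auto simp: in_keys_iff)

lemma free_action_0: "free_action T 0 f = (\<lambda>x. 0)"
  by (simp add: free_action_def)

lemma free_action_single: "free_action T (Poly_Mapping.single w c) f = (\<lambda>x. c * word_action T w f x)"
  by (auto simp: free_action_def)

lemma free_action_add: "free_action T (a + b) f = (\<lambda>x. free_action T a f x + free_action T b f x)"
proof
  fix x
  \<comment> \<open>Coefficients of \<open>a + b\<close> may cancel, so all three sums are taken
    over the union of the supports.\<close>
  let ?W = "Poly_Mapping.keys a \<union> Poly_Mapping.keys b"
  have "free_action T (a + b) f x = (\<Sum>w \<in> ?W. Poly_Mapping.lookup (a + b) w * word_action T w f x)"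
    by (rule free_action_superset) (use Poly_Mapping.keys_add[of a b] in auto)
  then show "free_action T (a + b) f x = free_action T a f x + free_action T b f x"
    by (simp add: free_action_superset[of ?W] lookup_add distrib_right sum.distrib)
qed

lemma free_action_scale: "free_action T (pm_scale c a) f = (\<lambda>x. c * free_action T a f x)"
proof
  fix x
  have "free_action T (pm_scale c a) f x =
      (\<Sum>w \<in> Poly_Mapping.keys a. Poly_Mapping.lookup (pm_scale c a) w * word_action T w f x)"
    by (rule free_action_superset) (auto simp: in_keys_iff)
  then show "free_action T (pm_scale c a) f x = c * free_action T a f x"
    by (simp add: free_action_def sum_distrib_left mult.assoc)
qed

lemma free_action_diff: "free_action T (a - b) f = (\<lambda>x. free_action T a f x - free_action T b f x)"
  using free_action_add[of "a - b" b f] by (auto simp: fun_eq_iff)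

lemma free_action_zero: "free_action T a (\<lambda>x. 0) = (\<lambda>x. 0)"
  by (simp add: free_action_def word_action_zero)

text \<open>Additivity in each factor reduces this to monomials, where concatenation of words is
  composition of operators.\<close>

lemma free_action_mult: "free_action T (a * b) f = free_action T a (free_action T b f)"
proof -
  have single: "free_action T (Poly_Mapping.single w c * b) f =
      (\<lambda>x. c * word_action T w (free_action T b f) x)" for w c
  proof (induction b rule: poly_mapping_add_single_induct)
    case zero
    show ?case by (simp add: free_action_0 word_action_zero)
  next
    case (add u d b)
    have "word_action T (w + u) f = word_action T w (word_action T u f)"
      by (simp add: word_action_def plus_word_def)
    then show ?case
      using add
      by (simp add: distrib_left mult_single free_action_add free_action_single word_action_add
          word_action_scale mult.assoc)
  qed
  show ?thesis
  proof (induction a rule: poly_mapping_add_single_induct)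
    case zero
    show ?case by (simp add: free_action_0)
  next
    case (add w c a)
    then show ?case
      by (simp add: distrib_right free_action_add single free_action_single)
  qed
qed

lemma free_action_sum: "free_action T (\<Sum>i \<in> I. a i) f = (\<lambda>x. \<Sum>i \<in> I. free_action T (a i) f x)"
  by (induction I rule: infinite_finite_induct) (simp_all add: free_action_0 free_action_add)

lemma free_action_generator: "free_action T (Poly_Mapping.single (Word [g]) 1) f = T g f"
  by (simp add: free_action_single word_action_def)

end

text \<open>The elements acting as zero form an ideal. The induction keeps \<open>f\<close>
  arbitrary because in \<open>x * a\<close> the factor \<open>x\<close> acts on the result of
  \<open>a\<close>.\<close>

lemma relator_ideal_acts_as_zero:
  assumes "linear_operators T" "\<And>r f. r \<in> relators G \<Longrightarrow> free_action T r f = (\<lambda>x. 0)"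
    "a \<in> relator_ideal G"
  shows "free_action T a f = (\<lambda>x. 0)"
proof -
  interpret linear_operators T by fact
  show ?thesis
    using assms(3)
  proof (induction a arbitrary: f rule: relator_ideal.induct)
    case zero
    show ?case by (rule free_action_0)
  next
    case relator
    then show ?case by (rule assms(2))
  qed (simp_all add: free_action_add free_action_scale free_action_mult free_action_zero)
qed

text \<open>A branching system: disjoint copies of an infinite set \<open>C\<close> indexed by the vertices, in which the
  copies over \<open>s(e)\<close> are partitioned into pieces equinumerous with the copies over \<open>r(e)\<close>. It exists
  because \<open>C\<close> absorbs products with sets of vertices and of edges.\<close>

lemma branching_system_exists:
  fixes G :: "('v, 'e) ultragraph"
  assumes "ultragraph G"
  obtains h :: "'e \<Rightarrow> 'v \<times> ('v + 'e + nat) \<Rightarrow> 'v \<times> ('v + 'e + nat)"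
  where "\<And>e y. e \<in> edges G \<Longrightarrow> fst (h e y) = src G e"
    and "\<And>e f y z. e \<in> edges G \<Longrightarrow> f \<in> edges G \<Longrightarrow> fst y \<in> rng G e \<Longrightarrow> fst z \<in> rng G f \<Longrightarrow>
      h e y = h f z \<Longrightarrow> e = f \<and> y = z"
    and "\<And>v c. is_regular G v \<Longrightarrow> \<exists>e y. e \<in> edges G \<and> src G e = v \<and> fst y \<in> rng G e \<and> h e y = (v, c)"
proof -
  interpret ultragraph G by fact
  let ?C = "UNIV :: ('v + 'e + nat) set"
  have inf: "infinite ?C"
    by simp
  \<comment> \<open>The summands of \<open>?C\<close> serve three ends: \<open>nat\<close> makes it
    infinite, while \<open>'v\<close> and \<open>'e\<close> let ranges and sets of edges embed in
    it.\<close>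
  have absorb: "\<exists>b. bij_betw b (?C \<times> B) ?C" if "B \<noteq> {}" "inj_on i B" for B and i :: "'y \<Rightarrow> 'v + 'e + nat"
  proof -
    have "(card_of B, card_of ?C) \<in> ordLeq"
      using that(2) card_of_ordLeq by blast
    then have "(card_of (?C \<times> B), card_of ?C) \<in> ordIso"
      using card_of_Times_infinite[OF inf that(1)] by blast
    then show ?thesis by (simp add: card_of_ordIso)
  qed
  \<comment> \<open>Splits the copy over \<open>v\<close> into one piece for each edge emitted by
    \<open>v\<close>.\<close>
  define b where "b v = (SOME b. bij_betw b (?C \<times> {e \<in> edges G. src G e = v}) ?C)" for v
  have b: "bij_betw (b v) (?C \<times> {e \<in> edges G. src G e = v}) ?C"
    if "{e \<in> edges G. src G e = v} \<noteq> {}" for v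
  proof -
    have "inj_on (\<lambda>e. Inr (Inl e)) {e \<in> edges G. src G e = v}" by (simp add: inj_on_def)
    from someI_ex[OF absorb[OF that this]] show ?thesis unfolding b_def .
  qed
  \<comment> \<open>Merges all copies over the vertices of \<open>rng G e\<close> into a single copy
    of \<open>?C\<close>.\<close>
  define k where "k e = (SOME k. bij_betw k (?C \<times> rng G e) ?C)" for e
  have k: "bij_betw (k e) (?C \<times> rng G e) ?C" if "e \<in> edges G" for e
  proof -
    have "inj_on Inl (rng G e)" by simp
    from someI_ex[OF absorb[OF rng_nonempty[OF that] this]] show ?thesis unfolding k_def .
  qed
  \<comment> \<open>The swap is there because points list the vertex first, while \<open>k e\<close>
    takes it second.\<close>
  define h where "h e y = (src G e, b (src G e) (k e (prod.swap y), e))" for e y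
  show ?thesis
  proof (rule that[of h])
    show "fst (h e y) = src G e" for e y by (simp add: h_def)
  next
    fix e f y z
    assume e: "e \<in> edges G" "f \<in> edges G" "fst y \<in> rng G e" "fst z \<in> rng G f" and eq: "h e y = h f z"
    then have s: "src G f = src G e" by (simp add: h_def)
    have "inj_on (b (src G e)) (?C \<times> {e' \<in> edges G. src G e' = src G e})"
      using b e(1) by (auto simp: bij_betw_def)
    then have ef: "k e (prod.swap y) = k f (prod.swap z) \<and> e = f"
      using eq s e(1,2) by (auto simp: h_def dest: inj_onD)
    have "inj_on (k e) (?C \<times> rng G e)"
      using k[OF e(1)] by (simp add: bij_betw_def)
    then have "prod.swap y = prod.swap z"
      using ef e(3,4) by (auto dest!: inj_onD simp: mem_Times_iff)
    then show "e = f \<and> y = z" using ef by (metis swap_swap)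
  next
    fix v c assume v: "is_regular G v"
    then have "c \<in> b v ` (?C \<times> {e \<in> edges G. src G e = v})"
      using b[of v] by (simp add: is_regular_def bij_betw_def)
    then obtain a e where e: "e \<in> edges G" "src G e = v" "b v (a, e) = c" by auto
    have "a \<in> k e ` (?C \<times> rng G e)"
      using k[OF e(1)] by (simp add: bij_betw_def)
    then obtain d w where "w \<in> rng G e" "k e (d, w) = a" by auto
    then have "h e (w, d) = (v, c)" "fst (w, d) \<in> rng G e" using e by (simp_all add: h_def)
    then show "\<exists>e y. e \<in> edges G \<and> src G e = v \<and> fst y \<in> rng G e \<and> h e y = (v, c)"
      using e by blast
  qed
qed

text \<open>On functions on the branching system, \<open>Sstar e\<close> acts by pulling back along
  \<open>h e\<close>, \<open>S e\<close> by transporting along \<open>h e\<close> and extending by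
  zero, and \<open>P A\<close> by restricting to the copies over \<open>A\<close>. All relators act
  as zero, but \<open>P {v}\<close> does not kill the constant 1.\<close>

lemma vertex_projection_nonzero:
  fixes G :: "('v, 'e) ultragraph"
  assumes "ultragraph G"
  shows "(\<iota> (P {v}) :: ('v, 'e, 'k::field) free_alg) \<notin> relator_ideal G"
proof
  interpret ultragraph G by fact
  obtain h :: "'e \<Rightarrow> 'v \<times> ('v + 'e + nat) \<Rightarrow> 'v \<times> ('v + 'e + nat)"
    where fst_h: "\<And>e y. e \<in> edges G \<Longrightarrow> fst (h e y) = src G e"
    and inj: "\<And>e f y z. e \<in> edges G \<Longrightarrow> f \<in> edges G \<Longrightarrow> fst y \<in> rng G e \<Longrightarrow> fst z \<in> rng G f \<Longrightarrow>
      h e y = h f z \<Longrightarrow> e = f \<and> y = z"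
    and cover: "\<And>v c. is_regular G v \<Longrightarrow>
      \<exists>e y. e \<in> edges G \<and> src G e = v \<and> fst y \<in> rng G e \<and> h e y = (v, c)"
    using branching_system_exists[OF assms] by blast
  define D where "D e = h e ` {y. fst y \<in> rng G e}" for e
  define T :: "('v, 'e) gen \<Rightarrow> ('v \<times> ('v + 'e + nat) \<Rightarrow> 'k) \<Rightarrow> 'v \<times> ('v + 'e + nat) \<Rightarrow> 'k" where
    "T g f x = (case g of
        P A \<Rightarrow> if fst x \<in> A then f x else 0
      | S e \<Rightarrow> if x \<in> D e then f (the_inv_into {y. fst y \<in> rng G e} (h e) x) else 0
      | Sstar e \<Rightarrow> if fst x \<in> rng G e then f (h e x) else 0)" for g f x
  have lin: "linear_operators T"
    by unfold_locales (auto simp: T_def fun_eq_iff split: gen.split)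
  interpret linear_operators T by fact
  have inj_h: "inj_on (h e) {y. fst y \<in> rng G e}" if "e \<in> edges G" for e
    using inj[OF that that] by (auto intro!: inj_onI)
  have TP: "T (P A) f x = (if fst x \<in> A then f x else 0)" for A f x
    by (simp add: T_def)
  have TSstar: "T (Sstar e) f x = (if fst x \<in> rng G e then f (h e x) else 0)" for e f x
    by (simp add: T_def)
  have TS: "T (S e) f (h e y) = f y" if "e \<in> edges G" "fst y \<in> rng G e" for e f y
    using that the_inv_into_f_f[OF inj_h[OF that(1)], of y] by (auto simp: T_def D_def)
  have TS_0: "T (S e) f x = 0" if "x \<notin> D e" for e f x
    using that by (simp add: T_def)
  have D_disj: "h e y \<notin> D f" if "e \<in> edges G" "f \<in> edges G" "e \<noteq> f" "fst y \<in> rng G e" for e f y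
    using inj[OF that(1,2,4)] that(3) by (auto simp: D_def)
  have T_src: "T (P {src G e}) (T (S e) f) x = T (S e) f x" if "e \<in> edges G" for e f x
    using fst_h[OF that] by (cases "x \<in> D e") (auto simp: TP TS_0 D_def)
  have T_S_rng: "T (S e) (T (P (rng G e)) f) x = T (S e) f x" if "e \<in> edges G" for e f x
    using that by (cases "x \<in> D e") (auto simp: TP TS TS_0 D_def)
  have T_Sstar_S: "T (Sstar e) (T (S f) g) x = (if e = f then T (P (rng G e)) g x else 0)"
    if "e \<in> edges G" "f \<in> edges G" for e f g x
    using that D_disj[of e f x] by (auto simp: TSstar TP TS TS_0)
  have T_regular: "T (P {u}) f x = (\<Sum>e \<in> {e \<in> edges G. src G e = u}. T (S e) (T (Sstar e) f) x)"
    if u: "is_regular G u" for u f x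
  proof (cases "fst x = u")
    case True
    then obtain e y where e: "e \<in> edges G" "src G e = u" "fst y \<in> rng G e" "h e y = x"
      using cover[OF u, of "snd x"] by auto
    have "T (S e') (T (Sstar e') f) x = 0" if "e' \<in> edges G" "e' \<noteq> e" for e'
      using D_disj[of e e' y] that e by (auto intro: TS_0)
    \<comment> \<open>The pieces \<open>D e\<close> are disjoint, so only the edge whose piece
      contains \<open>x\<close> contributes.\<close>
    then have "(\<Sum>e \<in> {e \<in> edges G. src G e = u}. T (S e) (T (Sstar e) f) x) =
        (\<Sum>e' \<in> {e}. T (S e') (T (Sstar e') f) x)"
      using u e by (intro sum.mono_neutral_right) (auto simp: is_regular_def)
    also have "\<dots> = f x"
      using e TS[OF e(1,3)] by (auto simp: TSstar)
    finally show ?thesis using True by (simp add: TP)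
  next
    case False
    then have "x \<notin> D e" if "e \<in> edges G" "src G e = u" for e
      using fst_h[OF that(1)] that(2) by (auto simp: D_def)
    then show ?thesis using False by (simp add: TP TS_0)
  qed
  note action = free_action_diff free_action_add free_action_mult free_action_sum free_action_0
    free_action_generator[folded \<iota>_def]
  have relators: "free_action T r f = (\<lambda>x. 0)" if "r \<in> relators G" for r f
    using that
  proof cases
    case p_empty
    then show ?thesis by (simp add: action TP fun_eq_iff)
  next
    case p_inter
    then show ?thesis by (simp add: action TP fun_eq_iff)
  next
    case p_union
    then show ?thesis by (simp add: action TP fun_eq_iff)
  next
    case src_s
    then show ?thesis by (simp add: action T_src)
  next
    case s_rng
    then show ?thesis by (simp add: action T_S_rng)
  next
    case rng_sstar
    then show ?thesis by (simp add: action TP TSstar fun_eq_iff)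
  next
    case (sstar_src e)
    then show ?thesis by (simp add: action TP TSstar fst_h fun_eq_iff)
  next
    case sstar_s
    then show ?thesis by (simp add: action T_Sstar_S)
  next
    case regular
    then show ?thesis by (simp add: action T_regular)
  qed
  assume "(\<iota> (P {v}) :: ('v, 'e, 'k) free_alg) \<in> relator_ideal G"
  then have "free_action T (\<iota> (P {v})) (\<lambda>_. 1) = (\<lambda>_. 0)"
    using relator_ideal_acts_as_zero[OF lin] relators by blast
  \<comment> \<open>Any point of the copy over \<open>v\<close> would serve;
    \<open>undefined\<close> is an arbitrary one.\<close>
  then have "T (P {v}) (\<lambda>_. 1) (v, undefined) = 0"
    by (simp add: action)
  then show False by (simp add: TP)
qed

section \<open>The graph conditions\<close>

theorem proposition7p3:
  fixes G :: "('v, 'e) ultragraph"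
  assumes "ultragraph G"
    and "RFUM2 G"
    and "residually_finite_dimensional
           (leavitt_path_algebra G :: ('k::field, ('v, 'e, 'k) free_alg set) kalg)"
  shows "graph_RFD G"
proof -
  interpret G: ultragraph G by fact
  \<comment> \<open>The representation depends on the vertex, so each condition below picks the
    vertex to be kept nonzero.\<close>
  have rep: thesis
    if "v \<in> verts G" "\<And>(V :: (nat \<Rightarrow>\<^sub>0 'k) set) F p s t.
      fin_dim_rep G V F p s t \<Longrightarrow> \<exists>x \<in> V. p {v} x \<noteq> 0 \<Longrightarrow> thesis" for v thesis
    using rep_nonzero_at[OF assms(1,3) that(1) vertex_projection_nonzero[OF assms(1)]] that(2)
    by metis
  show ?thesis
    unfolding graph_RFD_def
  proof (intro conjI)
    show "no_infinite_receivers G"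
      unfolding no_infinite_receivers_def
    proof
      fix v assume "v \<in> verts G"
      then show "finite {e \<in> edges G. v \<in> rng G e}"
      proof (rule rep)
        fix V F :: "(nat \<Rightarrow>\<^sub>0 'k) set" and p s t
        assume "fin_dim_rep G V F p s t" and nz: "\<exists>x \<in> V. p {v} x \<noteq> 0"
        then interpret fin_dim_rep G V F p s t by simp
        have "{e \<in> edges G. v \<in> rng G e} \<subseteq> {e \<in> edges G. \<exists>x \<in> V. s e x \<noteq> 0}"
          using nonzero_backward(1)[OF _ _ nz] by blast
        then show ?thesis using finite_nonzero_edges by (rule finite_subset)
      qed
    qed
    show "no_infinite_backward_chains G"
      unfolding no_infinite_backward_chains_def
    proof
      assume "\<exists>e :: nat \<Rightarrow> 'e. inj e \<and> range e \<subseteq> edges G \<and> (\<forall>i. src G (e i) \<in> rng G (e (Suc i)))"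
      then obtain e :: "nat \<Rightarrow> 'e" where e: "inj e" "\<And>i. e i \<in> edges G"
        "\<And>i. src G (e i) \<in> rng G (e (Suc i))" by blast
      show False
      proof (rule rep[OF G.src_in[OF e(2)[of 0]]])
        fix V F :: "(nat \<Rightarrow>\<^sub>0 'k) set" and p s t
        assume "fin_dim_rep G V F p s t" and nz: "\<exists>x \<in> V. p {src G (e 0)} x \<noteq> 0"
        then interpret fin_dim_rep G V F p s t by simp
        have nz_all: "\<exists>x \<in> V. p {src G (e i)} x \<noteq> 0" for i
          by (induction i) (use nz nonzero_backward(2) e(2,3) in blast)+
        \<comment> \<open>The index is shifted because nonvanishing at the source of
          \<open>e i\<close> yields that of the edge \<open>e (Suc i)\<close>, whose range contains
          this source.\<close>
        have "e (Suc i) \<in> {e \<in> edges G. \<exists>x \<in> V. s e x \<noteq> 0}" for i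
          using nonzero_backward(1)[OF e(2,3) nz_all] e(2) by blast
        then have "finite (range (\<lambda>i. e (Suc i)))"
          by (intro finite_subset[OF _ finite_nonzero_edges]) blast
        moreover have "inj (\<lambda>i. e (Suc i))"
          using e(1) by (auto intro!: injI dest: injD)
        ultimately show False
          using finite_imageD infinite_UNIV_nat by blast
      qed
    qed
    show "all_reach_terminal_or_cycle G"
      unfolding all_reach_terminal_or_cycle_def
    proof
      fix v assume v: "v \<in> verts G"
      then show "reaches_terminal G v \<or> reaches_cycle G v"
      proof (rule rep)
        fix V F :: "(nat \<Rightarrow>\<^sub>0 'k) set" and p s t
        assume "fin_dim_rep G V F p s t" and nz: "\<exists>x \<in> V. p {v} x \<noteq> 0"
        then interpret fin_dim_rep G V F p s t by simp
        show ?thesis by (rule reaches_if_nonzero[OF assms(2) v nz])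
      qed
    qed
    show "no_cycle_has_exit G"
      unfolding no_cycle_has_exit_def
    proof (intro allI impI notI)
      fix c assume c: "is_cycle G c" and "has_exit G c"
      \<comment> \<open>Thus the range of a cycle edge contains only the next cycle vertex, which
        settles both kinds of exit.\<close>
      have exit_vertex: False
        if i: "i < length c" "w \<in> rng G (c ! i)" "w \<noteq> src G (c ! (Suc i mod length c))" for i w
      proof -
        have "w \<in> verts G"
          using G.rng_sub[OF cycle_next(1)[OF c i(1)]] i(2) by blast
        then show False
        proof (rule rep)
          fix V F :: "(nat \<Rightarrow>\<^sub>0 'k) set" and p s t
          assume "fin_dim_rep G V F p s t" and nz: "\<exists>x \<in> V. p {w} x \<noteq> 0"
          then interpret fin_dim_rep G V F p s t by simp
          show False using cycle_exit_vertex_zero[OF c i] nz by blast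
        qed
      qed
      obtain i where i: "i < length c" and
        exit: "(\<exists>f \<in> edges G. src G f \<in> rng G (c ! i) \<and> f \<noteq> c ! (Suc i mod length c)) \<or>
          (\<exists>w \<in> rng G (c ! i). is_sink G w)"
        using \<open>has_exit G c\<close> unfolding has_exit_def by blast
      let ?j = "Suc i mod length c"
      have "0 < length c" using i by linarith
      then have j: "?j < length c" by simp
      note ej = cycle_next(1)[OF c j]
      from exit show False
      proof (elim disjE bexE conjE)
        fix f assume f: "f \<in> edges G" "src G f \<in> rng G (c ! i)" "f \<noteq> c ! ?j"
        then have sf: "src G f = src G (c ! ?j)"
          using exit_vertex[OF i] by blast
        \<comment> \<open>A representation nonzero at a vertex of \<open>rng G f\<close> forces
          \<open>s f\<close> to be nonzero, whereas the cycle forces it to vanish.\<close>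
        obtain w where w: "w \<in> rng G f" "w \<in> verts G"
          using G.rng_nonempty[OF f(1)] G.rng_sub[OF f(1)] by blast
        from w(2) show False
        proof (rule rep)
          fix V F :: "(nat \<Rightarrow>\<^sub>0 'k) set" and p s t
          assume "fin_dim_rep G V F p s t" and nz: "\<exists>x \<in> V. p {w} x \<noteq> 0"
          then interpret fin_dim_rep G V F p s t by simp
          show False
            using cycle_exit_edge_zero[OF c j f(1) sf f(3)] nonzero_backward(1)[OF f(1) w(1) nz]
            by blast
        qed
      next
        fix w assume w: "w \<in> rng G (c ! i)" "is_sink G w"
        \<comment> \<open>The next cycle vertex emits \<open>c ! ?j\<close>, so it is not a
          sink.\<close>
        then have "w \<noteq> src G (c ! ?j)"
          using ej by (auto simp: is_sink_def)
        then show False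
          using exit_vertex[OF i w(1)] by blast
      qed
    qed
  qed
qed

end
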